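(* Let $c\in[0,\infty)$ and let $p_n\in[0,1]$ be such that $\lim_{n\to\infty} n p_n/\ln n=c$. Consider the fire dynamics with parameter $p_n$ on a random recursive tree $\mathsf{T}_n$ with $n$ vertices, and let $X_n$ be a uniform random vertex in $[n]$ independent of $\mathsf{T}_n$ and of the fire dynamics. Then the probability that $X_n$ and $1$ belong to the same fireproof subtree converges to $\mathrm{e}^{-c}$ as $n\to\infty$.
   Context: Write $[n]=\{1,\dots,n\}$. A tree on the vertex set $[n]$ is called recursive if, when rooted at $1$, the sequence of vertices along any branch from the root to a leaf is increasing. There are $(n-1)!$ such trees; the random recursive tree $\mathsf{T}_n$ is one of them picked uniformly at random. Fire dynamics with parameter $p_n$ on a tree with $n$ vertices: initially every edge is flammable. The edges are considered successively in a uniform random order; an edge which has already burnt is not subject to the dynamics any more and is skipped. Otherwise, independently of everything else, the edge becomes fireproof with probability $1-p_n$ or is set on fire with probability $p_n$; in the latter case the edge burns, sets on fire its flammable neighbouring edges, and the fire propagates instantly, stopped only by fireproof edges (so that the whole connected set of flammable edges containing it burns). The dynamics continue until all edges are either burnt or fireproof. A vertex is called fireproof if all its adjacent edges are fireproof, and burnt otherwise. The fireproof edges with at least one burnt extremity are then discarded; the connected components of the resulting forest are either composed of fireproof vertices (the fireproof subtrees) or of burnt vertices (the burnt subtrees). *)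

theory Defs
  imports "HOL-Probability.Probability" "HOL-Combinatorics.Multiset_Permutations"
begin

section \<open>Undirected trees and recursive trees\<close>

text \<open>
  A simple graph is given by a vertex set \<open>V\<close> and a set \<open>E\<close> of two-element subsets of \<open>V\<close>.
\<close>

definition is_graph :: "nat set \<Rightarrow> nat set set \<Rightarrow> bool" where
  "is_graph V E \<longleftrightarrow> (\<forall>e\<in>E. e \<subseteq> V \<and> card e = 2)"

definition simple_path :: "nat set set \<Rightarrow> nat list \<Rightarrow> bool" where
  "simple_path E xs \<longleftrightarrow> xs \<noteq> [] \<and> distinct xs \<and> successively (\<lambda>u v. {u, v} \<in> E) xs"

definition simple_cycle :: "nat set set \<Rightarrow> nat list \<Rightarrow> bool" where
  "simple_cycle E xs \<longleftrightarrow> simple_path E xs \<and> length xs \<ge> 3 \<and> {last xs, hd xs} \<in> E"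

text \<open>\<open>same_component E u v\<close>: the vertices \<open>u\<close> and \<open>v\<close> are joined by a walk (possibly of length 0).\<close>

definition same_component :: "nat set set \<Rightarrow> nat \<Rightarrow> nat \<Rightarrow> bool" where
  "same_component E u v \<longleftrightarrow> (\<lambda>x y. {x, y} \<in> E)\<^sup>*\<^sup>* u v"

definition components_of :: "nat set \<Rightarrow> nat set set \<Rightarrow> nat set set" where
  "components_of V E = {{v \<in> V. same_component E u v} | u. u \<in> V}"

definition is_tree :: "nat set \<Rightarrow> nat set set \<Rightarrow> bool" where
  "is_tree V E \<longleftrightarrow> is_graph V E \<and> V \<noteq> {} \<and>
     (\<forall>u\<in>V. \<forall>v\<in>V. same_component E u v) \<and> (\<nexists>xs. simple_cycle E xs)"

text \<open>Leaves of the tree rooted at 1; the root itself is not a leaf, even if it has degree one.\<close>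

definition is_leaf :: "nat set \<Rightarrow> nat set set \<Rightarrow> nat \<Rightarrow> bool" where
  "is_leaf V E v \<longleftrightarrow> v \<in> V \<and> v \<noteq> 1 \<and> card {e \<in> E. v \<in> e} = 1"

definition recursive_tree :: "nat \<Rightarrow> nat set set \<Rightarrow> bool" where
  "recursive_tree n E \<longleftrightarrow> is_tree {1..n} E \<and>
     (\<forall>xs. simple_path E xs \<and> hd xs = 1 \<and> is_leaf {1..n} E (last xs) \<longrightarrow> sorted_wrt (<) xs)"

text \<open>Only meaningful for \<open>n \<ge> 1\<close>, when there is at least one recursive tree on \<open>{1..n}\<close>.\<close>

definition random_recursive_tree :: "nat \<Rightarrow> nat set set pmf" where
  "random_recursive_tree n = pmf_of_set {E. recursive_tree n E}"


section \<open>Fire dynamics\<close>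

datatype edge_state = Flammable | Fireproof | Burnt

type_synonym fire_config = "nat set \<Rightarrow> edge_state"

text \<open>
  The connected set of flammable edges of \<open>E\<close> containing the flammable edge \<open>e\<close>;
  two edges are neighbours if they share an endpoint.
\<close>

definition flammable_cluster :: "nat set set \<Rightarrow> fire_config \<Rightarrow> nat set \<Rightarrow> nat set set" where
  "flammable_cluster E s e =
     {f. (\<lambda>a b. a \<in> E \<and> b \<in> E \<and> s a = Flammable \<and> s b = Flammable \<and> a \<inter> b \<noteq> {})\<^sup>*\<^sup>* e f}"

definition burn :: "nat set set \<Rightarrow> nat set \<Rightarrow> fire_config \<Rightarrow> fire_config" where
  "burn E e s = (\<lambda>f. if f \<in> flammable_cluster E s e then Burnt else s f)"

fun fire_run :: "real \<Rightarrow> nat set set \<Rightarrow> nat set list \<Rightarrow> fire_config \<Rightarrow> fire_config pmf" where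
  "fire_run p E [] s = return_pmf s"
| "fire_run p E (e # es) s =
     (if s e = Burnt then fire_run p E es s
      else do {
        fire \<leftarrow> bernoulli_pmf p;
        fire_run p E es (if fire then burn E e s else s(e := Fireproof))
      })"

text \<open>The law of the final configuration, with edges examined in uniform random order.\<close>

definition fire_dynamics :: "real \<Rightarrow> nat set set \<Rightarrow> fire_config pmf" where
  "fire_dynamics p E = do {
     es \<leftarrow> pmf_of_set (permutations_of_set E);
     fire_run p E es (\<lambda>_. Flammable)
   }"

definition fireproof_vertex :: "nat set set \<Rightarrow> fire_config \<Rightarrow> nat \<Rightarrow> bool" where
  "fireproof_vertex E s v \<longleftrightarrow> (\<forall>e\<in>E. v \<in> e \<longrightarrow> s e = Fireproof)"

text \<open>The edges left once the fireproof edges with a burnt extremity are discarded.\<close>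

definition remaining_edges :: "nat set set \<Rightarrow> fire_config \<Rightarrow> nat set set" where
  "remaining_edges E s = E - {e \<in> E. s e = Fireproof \<and> (\<exists>v\<in>e. \<not> fireproof_vertex E s v)}"

text \<open>Subtrees of the remaining forest are identified with their vertex sets.\<close>

definition fireproof_subtrees :: "nat set \<Rightarrow> nat set set \<Rightarrow> fire_config \<Rightarrow> nat set set" where
  "fireproof_subtrees V E s =
     {C \<in> components_of V (remaining_edges E s). \<forall>v\<in>C. fireproof_vertex E s v}"

text \<open>
  The joint law of the random recursive tree, the final configuration of the fire dynamics on it,
  and an independent uniform vertex.
\<close>

definition fire_model :: "nat \<Rightarrow> real \<Rightarrow> ((nat set set \<times> fire_config) \<times> nat) pmf" where
  "fire_model n p =
     pair_pmf
       (do {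
          T \<leftarrow> random_recursive_tree n;
          s \<leftarrow> fire_dynamics p T;
          return_pmf (T, s)
        })
       (pmf_of_set {1..n})"

end

theory Submission
  imports Defs "HOL-Real_Asymp.Real_Asymp"
begin

text \<open>
  The vertices \<open>X\<close> and \<open>1\<close> lie in the same fireproof subtree iff every vertex of the path \<open>S\<close> between them
  is fireproof. Given the tree and the order of the edges, this has probability \<open>(1 - p) ^ K\<close>, where
  \<open>K\<close> counts the edges that, when examined, are still joined to \<open>S\<close> by unexamined edges, i.e. that
  come first among the edges between them and \<open>S\<close>. An edge at distance \<open>d\<close> from \<open>S\<close>
  contributes with probability \<open>1 / d\<close>.

  Let \<open>g v w\<close> be the number of edges between \<open>v\<close> and the path from \<open>1\<close> to \<open>w\<close>. Adding vertex \<open>n + 1\<close> to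
  the tree gives a linear recursion for the mean of the sum of \<open>x ^ g v w\<close> over all \<open>v, w\<close>, so that this
  mean is \<open>O(n powr (1 + x))\<close>, and by Chernoff's method \<open>g v w\<close> is at least \<open>(1 - \<epsilon>) ln n\<close> for most pairs.
  Hence the mean of \<open>K\<close> is at most \<open>(1 + o(1)) n / ln n\<close>, which yields the lower bound by convexity of \<open>exp\<close>.
  For the upper bound only the root is required to be fireproof, that is \<open>S = {1}\<close>; then the mean of \<open>K\<close>
  is at least \<open>(n - 2) / ln n\<close>, and its second moment is at most \<open>(1 + o(1)) (n / ln n)\<^sup>2\<close> because the
  edges above \<open>u\<close> and \<open>v\<close> have to come first in disjoint sets of \<open>g u v\<close> and \<open>g v u\<close> edges.
\<close>

section \<open>Fires reaching a set of vertices\<close>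

text \<open>\<open>R\<close> is meant as the set of unexamined edges: \<open>e\<close> belongs to
  the set when a fire started at \<open>e\<close> and free to spread through \<open>R\<close> would
  burn an edge at \<open>S\<close>.\<close>

inductive_set edges_reached :: "nat set \<Rightarrow> nat set set \<Rightarrow> nat set set" for S R where
  touch: "e \<in> R \<Longrightarrow> e \<inter> S \<noteq> {} \<Longrightarrow> e \<in> edges_reached S R"
| step: "f \<in> edges_reached S R \<Longrightarrow> e \<in> R \<Longrightarrow> e \<inter> f \<noteq> {} \<Longrightarrow> e \<in> edges_reached S R"

text \<open>The count \<open>K\<close> of the overview. Edge states do not enter it, so the
  randomness of the order is separated from that of the fires.\<close>

fun hits :: "nat set \<Rightarrow> nat set list \<Rightarrow> nat" where
  "hits S [] = 0"
| "hits S (e # es) = of_bool (e \<in> edges_reached S (set (e # es))) + hits S es"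

lemma edges_reached_subset: "edges_reached S R \<subseteq> R"
  by (auto elim: edges_reached.cases)

lemma edges_reached_mono:
  assumes "S \<subseteq> S'" "R \<subseteq> R'"
  shows "edges_reached S R \<subseteq> edges_reached S' R'"
proof
  fix e assume "e \<in> edges_reached S R"
  then show "e \<in> edges_reached S' R'"
    by induction (use assms in \<open>auto intro: edges_reached.intros\<close>)
qed

lemma hits_mono: "S \<subseteq> S' \<Longrightarrow> hits S es \<le> hits S' es"
proof (induction es)
  case (Cons e es)
  then have "edges_reached S (set (e # es)) \<subseteq> edges_reached S' (set (e # es))"
    by (intro edges_reached_mono) auto
  with Cons show ?case by (auto intro!: add_mono)
qed simp

text \<open>The suffix of \<open>es\<close> starting at \<open>e\<close> holds the edges unexamined
  when \<open>e\<close> comes up. The index set of the sum no longer depends on the order, so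
  expectations can be taken edge by edge.\<close>

lemma hits_eq_sum:
  "distinct es \<Longrightarrow>
     hits S es = (\<Sum>e\<in>set es. of_bool (e \<in> edges_reached S (set (dropWhile (\<lambda>x. x \<noteq> e) es))))"
proof (induction es)
  case (Cons e es)
  have "(\<Sum>f\<in>set es. of_bool (f \<in> edges_reached S (set (dropWhile (\<lambda>x. x \<noteq> f) (e # es))))) =
        (\<Sum>f\<in>set es. of_bool (f \<in> edges_reached S (set (dropWhile (\<lambda>x. x \<noteq> f) es))) :: nat)"
    using Cons.prems by (intro sum.cong) auto
  with Cons have "hits S es = (\<Sum>f\<in>set es. of_bool (f \<in> edges_reached S (set (dropWhile (\<lambda>x. x \<noteq> f) (e # es)))))"
    by simp
  moreover have "dropWhile (\<lambda>x. x \<noteq> e) (e # es) = e # es" "e \<notin> set es" using Cons.prems by auto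
  ultimately show ?case
    unfolding hits.simps list.simps(15)[of e es] by (subst sum.insert) auto
qed simp

lemma prob_bind_pmf:
  "measure_pmf.prob (bind_pmf M N) A = measure_pmf.expectation M (\<lambda>x. measure_pmf.prob (N x) A)"
proof -
  have "ennreal (measure_pmf.prob (bind_pmf M N) A) = emeasure (bind_pmf M N) A"
    by (simp add: measure_pmf.emeasure_eq_measure)
  also have "\<dots> = (\<integral>\<^sup>+x. ennreal (measure_pmf.prob (N x) A) \<partial>M)"
    unfolding measure_pmf.emeasure_eq_measure[symmetric] by simp
  also have "\<dots> = ennreal (measure_pmf.expectation M (\<lambda>x. measure_pmf.prob (N x) A))"
    by (intro nn_integral_eq_integral measure_pmf.integrable_const_bound[where B = 1]) auto
  finally show ?thesis by (simp add: integral_nonneg)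
qed

text \<open>The closure defining the cluster is reflexive, so \<open>e\<close> itself has to be
  assumed to be a flammable edge.\<close>

lemma flammable_cluster_Flammable:
  assumes "f \<in> flammable_cluster E s e" "s e = Flammable" "e \<in> E"
  shows "f \<in> E \<and> s f = Flammable"
  using assms(1) unfolding flammable_cluster_def mem_Collect_eq
  by (cases rule: rtranclp.cases) (use assms in auto)

text \<open>Being reached passes backwards along the chain from \<open>e\<close> to
  \<open>f\<close>, whose edges are flammable and hence in \<open>R\<close>. Read contrapositively:
  a fire started at an edge that is not reached burns no reached edge.\<close>

lemma flammable_cluster_reached:
  assumes "f \<in> flammable_cluster E s e" "f \<in> edges_reached S R" "{g \<in> E. s g = Flammable} \<subseteq> R"
    "s e = Flammable" "e \<in> E"
  shows "e \<in> edges_reached S R"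
proof -
  let ?r = "\<lambda>a b. a \<in> E \<and> b \<in> E \<and> s a = Flammable \<and> s b = Flammable \<and> a \<inter> b \<noteq> {}"
  have "?r\<^sup>*\<^sup>* e f" using assms(1) by (simp add: flammable_cluster_def)
  then show ?thesis using assms(2)
  proof (induction rule: rtranclp_induct)
    case (step y z)
    then show ?case using assms(3) by (blast intro: edges_reached.step)
  qed
qed

text \<open>While all reached edges are flammable, the chain witnessing that \<open>e\<close> is
  reached lies inside the cluster of \<open>e\<close>.\<close>

lemma reached_cluster_touches:
  assumes "e \<in> edges_reached S R" "edges_reached S R \<subseteq> {g \<in> E. s g = Flammable}"
  shows "\<exists>f \<in> flammable_cluster E s e. f \<in> E \<and> f \<inter> S \<noteq> {}"
proof -
  let ?r = "\<lambda>a b. a \<in> E \<and> b \<in> E \<and> s a = Flammable \<and> s b = Flammable \<and> a \<inter> b \<noteq> {}"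
  from assms(1) have "\<exists>f. ?r\<^sup>*\<^sup>* e f \<and> f \<in> E \<and> f \<inter> S \<noteq> {}"
  proof induction
    case (touch e)
    then have "e \<in> edges_reached S R" by (rule edges_reached.touch)
    then have "e \<in> E" using assms(2) by auto
    with touch show ?case by blast
  next
    case (step f e)
    then obtain g where g: "?r\<^sup>*\<^sup>* f g" "g \<in> E" "g \<inter> S \<noteq> {}" by auto
    have "e \<in> edges_reached S R" using step by (auto intro: edges_reached.step)
    then have "?r e f" using step assms(2) by blast
    with g(1) have "?r\<^sup>*\<^sup>* e g" by (rule converse_rtranclp_into_rtranclp[rotated])
    with g show ?case by blast
  qed
  then show ?thesis by (auto simp: flammable_cluster_def)
qed

lemma burn_Burnt: "s f = Burnt \<Longrightarrow> burn E e s f = Burnt"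
  by (simp add: burn_def)

text \<open>Burnt edges stay burnt, so one burnt edge at \<open>S\<close> rules out the event for
  good.\<close>

lemma fire_run_prob_Burnt:
  assumes "distinct es" "s f = Burnt"  "f \<in> E" "f \<inter> S \<noteq> {}"
  shows "measure_pmf.prob (fire_run p E es s) {s'. \<forall>v\<in>S. fireproof_vertex E s' v} = 0"
  using assms
proof (induction es arbitrary: s)
  case Nil
  then have "\<not> (\<forall>v\<in>S. fireproof_vertex E s v)"
    unfolding fireproof_vertex_def by (metis Int_emptyI edge_state.distinct(5))
  then show ?case by (auto simp: measure_return_pmf indicator_def)
next
  case (Cons e es)
  have "(if b then burn E e s else s(e := Fireproof)) f = Burnt \<or> s e = Burnt" for b
    using Cons.prems by (auto simp: burn_Burnt)
  with Cons show ?case by (auto simp: prob_bind_pmf)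
qed

text \<open>A fire can only reach \<open>S\<close> from an edge that is still joined to \<open>S\<close> by unexamined edges, and
  as long as no such fire starts, the state of these edges is unaffected by fires elsewhere. So every
  hit multiplies the probability by \<open>1 - p\<close>.\<close>

lemma fire_run_prob:
  assumes "0 \<le> p" "p \<le> 1" "distinct es" "set es \<subseteq> E"
    and "\<And>f. f \<in> E - set es \<Longrightarrow> s f \<noteq> Flammable"
    and "\<And>f. f \<in> set es \<Longrightarrow> s f \<noteq> Fireproof"
    and "\<And>f. f \<in> edges_reached S (set es) \<Longrightarrow> s f = Flammable"
    and "\<And>f. f \<in> E \<Longrightarrow> f \<inter> S \<noteq> {} \<Longrightarrow> s f \<noteq> Burnt"
  shows "measure_pmf.prob (fire_run p E es s) {s'. \<forall>v\<in>S. fireproof_vertex E s' v} = (1 - p) ^ hits S es"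
  using assms(3-8)
proof (induction es arbitrary: s)
  case Nil
  then have "\<forall>v\<in>S. fireproof_vertex E s v"
    unfolding fireproof_vertex_def by (metis Diff_empty Int_iff edge_state.exhaust empty_iff empty_set)
  then show ?case by (auto simp: measure_return_pmf)
next
  case (Cons e es)
  let ?A = "{s'. \<forall>v\<in>S. fireproof_vertex E s' v}"
  let ?C = "edges_reached S (set (e # es))"
  have e: "e \<in> E" "e \<notin> set es" "s e \<noteq> Fireproof" using Cons.prems by auto
  have sub: "edges_reached S (set es) \<subseteq> ?C" by (intro edges_reached_mono) auto
  have notin: "e \<notin> edges_reached S (set es)" using e edges_reached_subset by blast
  show ?case
  proof (cases "s e")
    case Burnt
    \<comment> \<open>A skipped edge cannot be a hit, since reached edges are flammable.\<close>
    then have "e \<notin> ?C" using Cons.prems(5) by force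
    moreover have "measure_pmf.prob (fire_run p E es s) ?A = (1 - p) ^ hits S es"
    proof (rule Cons.IH)
      show "s f \<noteq> Flammable" if "f \<in> E - set es" for f
        using that Cons.prems(3)[of f] Burnt by (cases "f = e") auto
    qed (use Cons.prems sub in auto)
    ultimately show ?thesis using Burnt by simp
  next
    case Fireproof
    with e show ?thesis by simp
  next
    case Flammable
    have no: "measure_pmf.prob (fire_run p E es (s(e := Fireproof))) ?A = (1 - p) ^ hits S es"
    proof (rule Cons.IH)
      show "(s(e := Fireproof)) f \<noteq> Flammable" if "f \<in> E - set es" for f
        using that Cons.prems(3)[of f] by (cases "f = e") auto
      show "(s(e := Fireproof)) f = Flammable" if "f \<in> edges_reached S (set es)" for f
        using that Cons.prems(5)[of f] sub notin by auto
    qed (use Cons.prems e in auto)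
    have flam: "{g \<in> E. s g = Flammable} \<subseteq> set (e # es)"
      using Cons.prems(3) by auto
    show ?thesis
    proof (cases "e \<in> ?C")
      case True
      have "?C \<subseteq> {g \<in> E. s g = Flammable}"
        using Cons.prems(2,5) edges_reached_subset by blast
      with True obtain f where f: "f \<in> flammable_cluster E s e" "f \<in> E" "f \<inter> S \<noteq> {}"
        using reached_cluster_touches by metis
      \<comment> \<open>Fire at \<open>e\<close> destroys the event, so only the fireproof outcome
        contributes, with weight \<open>1 - p\<close>.\<close>
      then have "burn E e s f = Burnt" by (simp add: burn_def)
      then have "measure_pmf.prob (fire_run p E es (burn E e s)) ?A = 0"
        using fire_run_prob_Burnt[of es "burn E e s" f E S p] Cons.prems f by simp
      with no True Flammable show ?thesis
        using assms(1,2) by (simp add: prob_bind_pmf)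
    next
      case False
      have away: "f \<notin> ?C" if "f \<in> flammable_cluster E s e" for f
        using flammable_cluster_reached[OF that _ flam Flammable e(1), of S] False by blast
      have "measure_pmf.prob (fire_run p E es (burn E e s)) ?A = (1 - p) ^ hits S es"
      proof (rule Cons.IH)
        show "burn E e s f \<noteq> Flammable" if "f \<in> E - set es" for f
        proof (cases "f = e")
          case True
          then show ?thesis by (simp add: burn_def flammable_cluster_def)
        next
          case False
          then show ?thesis using Cons.prems(3)[of f] that by (auto simp: burn_def)
        qed
        show "burn E e s f = Flammable" if "f \<in> edges_reached S (set es)" for f
          using Cons.prems(5)[of f] sub away that by (auto simp: burn_def)
        show "burn E e s f \<noteq> Burnt" if f: "f \<in> E" "f \<inter> S \<noteq> {}" for f
        proof (cases "f \<in> flammable_cluster E s e")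
          case True
          then have "s f = Flammable"
            using flammable_cluster_Flammable Flammable e by blast
          then have "f \<in> ?C" using flam f by (auto intro!: edges_reached.touch)
          then show ?thesis using away True by blast
        next
          case False
          then show ?thesis using Cons.prems(6)[OF f] by (simp add: burn_def)
        qed
      qed (use Cons.prems in \<open>auto simp: burn_def\<close>)
      \<comment> \<open>Both outcomes lead to the same power, and their weights \<open>p\<close> and
        \<open>1 - p\<close> add up to one.\<close>
      with no False Flammable show ?thesis
        using assms(1,2) by (simp add: prob_bind_pmf algebra_simps)
    qed
  qed
qed

lemma fire_dynamics_run_prob:
  assumes "0 \<le> p" "p \<le> 1" "es \<in> permutations_of_set E"
  shows "measure_pmf.prob (fire_run p E es (\<lambda>_. Flammable)) {s'. \<forall>v\<in>S. fireproof_vertex E s' v} =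
    (1 - p) ^ hits S es"
  using permutations_of_setD[OF assms(3)] assms(1,2) by (intro fire_run_prob) auto

section \<open>Recursive trees as parent maps\<close>

lemma same_component_refl [simp]: "same_component E u u"
  by (simp add: same_component_def)

lemma same_component_trans: "same_component E u v \<Longrightarrow> same_component E v w \<Longrightarrow> same_component E u w"
  unfolding same_component_def by (rule rtranclp_trans)

lemma same_component_edge: "{u, v} \<in> E \<Longrightarrow> same_component E u v"
  by (auto simp: same_component_def)

lemma same_component_sym:
  assumes "same_component E u v"
  shows "same_component E v u"
proof -
  have "(\<lambda>x y. {x, y} \<in> E)\<inverse>\<inverse> = (\<lambda>x y. {x, y} \<in> E)"
    by (auto simp: fun_eq_iff insert_commute)
  then show ?thesis
    using assms unfolding same_component_def by (metis rtranclp_conversep conversepI)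
qed

lemma same_component_induct [consumes 1, case_names refl step]:
  assumes "same_component E u v" "P u"
    "\<And>v w. same_component E u v \<Longrightarrow> {v, w} \<in> E \<Longrightarrow> P v \<Longrightarrow> P w"
  shows "P v"
  using assms unfolding same_component_def by (rule rtranclp_induct)

section \<open>Trees built from parent maps\<close>

definition parent_maps :: "nat \<Rightarrow> (nat \<Rightarrow> nat) set" where
  "parent_maps n = (\<Pi>\<^sub>E v\<in>{2..n}. {1..<v})"

definition edges_of :: "nat \<Rightarrow> (nat \<Rightarrow> nat) \<Rightarrow> nat set set" where
  "edges_of n f = (\<lambda>v. {f v, v}) ` {2..n}"

lemma parent_maps_bounds:
  assumes "f \<in> parent_maps n" "2 \<le> v" "v \<le> n"
  shows "1 \<le> f v" "f v < v"
  using assms by (auto simp: parent_maps_def PiE_iff)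

text \<open>The larger endpoint of an edge identifies the vertex it lies above.\<close>

lemma edge_eq_iff:
  assumes "f \<in> parent_maps n" "g \<in> parent_maps n" "u \<in> {2..n}" "v \<in> {2..n}"
  shows "{f u, u} = {g v, v} \<longleftrightarrow> u = v \<and> f u = g v"
  using parent_maps_bounds[OF assms(1), of u] parent_maps_bounds[OF assms(2), of v] assms(3,4)
  by (auto simp: doubleton_eq_iff)

lemma inj_on_edge:
  assumes "f \<in> parent_maps n"
  shows "inj_on (\<lambda>v. {f v, v}) {2..n}"
  using edge_eq_iff[OF assms assms] by (auto intro!: inj_onI)

text \<open>The edge with larger endpoint \<open>v\<close> reveals the parent of \<open>v\<close>;
  outside \<open>{2..n}\<close> all parent maps agree because they are extensional.\<close>

lemma inj_on_edges_of: "inj_on (edges_of n) (parent_maps n)"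
proof (rule inj_onI)
  fix f g assume f: "f \<in> parent_maps n" and g: "g \<in> parent_maps n" and eq: "edges_of n f = edges_of n g"
  have "f v = g v" if "v \<in> {2..n}" for v
  proof -
    have "{f v, v} \<in> edges_of n g" unfolding eq[symmetric] using that by (simp add: edges_of_def)
    then obtain u where "u \<in> {2..n}" "{f v, v} = {g u, u}" unfolding edges_of_def by blast
    then show ?thesis using edge_eq_iff[OF f g that] by blast
  qed
  then show "f = g" using f g unfolding parent_maps_def by (rule PiE_ext[rotated 2])
qed

lemma mem_edges_of_iff:
  assumes "f \<in> parent_maps n" "u < v"
  shows "{u, v} \<in> edges_of n f \<longleftrightarrow> v \<in> {2..n} \<and> u = f v"
proof
  assume "{u, v} \<in> edges_of n f"
  then obtain w where w: "w \<in> {2..n}" "{u, v} = {f w, w}" by (auto simp: edges_of_def)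
  then show "v \<in> {2..n} \<and> u = f v"
    using assms(2) parent_maps_bounds[OF assms(1), of w] by (auto simp: doubleton_eq_iff)
qed (auto simp: edges_of_def)

lemma same_component_edges_of:
  assumes "f \<in> parent_maps n" "v \<in> {1..n}"
  shows "same_component (edges_of n f) v 1"
  using assms(2)
proof (induction v rule: less_induct)
  case (less v)
  show ?case
  proof (cases "v = 1")
    case False
    then have v: "2 \<le> v" "v \<le> n" using less.prems by auto
    have "same_component (edges_of n f) (f v) 1"
      using parent_maps_bounds[OF assms(1) v] v by (intro less.IH) auto
    moreover have "{v, f v} \<in> edges_of n f" using v by (auto simp: edges_of_def)
    ultimately show ?thesis by (meson same_component_edge same_component_trans)
  qed simp
qed

text \<open>The largest vertex of a cycle would have two distinct parents.\<close>

lemma no_cycle_edges_of: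
  assumes "f \<in> parent_maps n"
  shows "\<not> simple_cycle (edges_of n f) xs"
proof
  assume cyc: "simple_cycle (edges_of n f) xs"
  then have dist: "distinct xs" and len: "3 \<le> length xs"
    and succ: "successively (\<lambda>u v. {u, v} \<in> edges_of n f) xs"
    and close: "{last xs, hd xs} \<in> edges_of n f"
    by (auto simp: simple_cycle_def simple_path_def)
  define k where "k = length xs"
  have adj: "{xs ! i, xs ! (Suc i mod k)} \<in> edges_of n f" if "i < k" for i
  proof (cases "Suc i < k")
    case True
    then show ?thesis using succ by (simp add: successively_conv_nth k_def)
  next
    case False
    with that have "i = k - 1" "Suc i = k" by simp_all
    moreover have "xs \<noteq> []" using len by auto
    ultimately show ?thesis using close
      by (simp add: last_conv_nth hd_conv_nth k_def)
  qed
  have "xs \<noteq> []" using len by auto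
  then obtain i where i: "i < k" "xs ! i = Max (set xs)"
    by (metis List.finite_set Max_in in_set_conv_nth k_def set_empty)
  \<comment> \<open>\<open>j\<close> is the cyclic predecessor of the position \<open>i\<close> of
    the maximum.\<close>
  define j where "j = (if i = 0 then k - 1 else i - 1)"
  have j: "j < k" "Suc j mod k = i" using i len by (auto simp: j_def k_def)
  \<comment> \<open>Length at least 3 is what makes the two cyclic neighbours of \<open>i\<close>
    distinct.\<close>
  have ij: "Suc i mod k < k" "Suc i mod k \<noteq> i" "j \<noteq> i" "j \<noteq> Suc i mod k"
    using i len by (auto simp: j_def k_def mod_Suc)
  have less: "xs ! l < xs ! i" if "l < k" "l \<noteq> i" for l
    using that i dist nth_eq_iff_index_eq[of xs l i] Max_ge[of "set xs" "xs ! l"]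
    by (auto simp: k_def le_neq_implies_less)
  have "{xs ! j, xs ! i} \<in> edges_of n f" "{xs ! (Suc i mod k), xs ! i} \<in> edges_of n f"
    using adj[of i] adj[of j] i j by (auto simp: insert_commute)
  then have "xs ! j = xs ! (Suc i mod k)"
    using mem_edges_of_iff[OF assms] less ij j by metis
  then show False
    using dist ij j by (simp add: nth_eq_iff_index_eq k_def)
qed

text \<open>A descent from \<open>u\<close> to \<open>y\<close> would have to go to the parent of
  \<open>u\<close>. As the path increases up to \<open>u\<close>, the vertex before \<open>u\<close>
  is already that parent, so the path would repeat it.\<close>

lemma sorted_path_edges_of:
  assumes "f \<in> parent_maps n" "simple_path (edges_of n f) xs" "hd xs = 1"
  shows "sorted_wrt (<) xs"
  using assms(2,3)
proof (induction xs rule: rev_induct)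
  case (snoc y xs)
  show ?case
  proof (cases "xs = []")
    case False
    have path: "simple_path (edges_of n f) xs" "hd xs = 1" and y: "y \<notin> set xs"
      and edge: "{last xs, y} \<in> edges_of n f"
      using snoc.prems False by (auto simp: simple_path_def successively_append_iff)
    then have sorted: "sorted_wrt (<) xs" using snoc.IH by blast
    obtain ys u where xs: "xs = ys @ [u]" using False by (metis rev_exhaust)
    have "u < y"
    proof (rule ccontr)
      assume "\<not> u < y"
      with y xs have "y < u" by auto
      with edge xs have yu: "y = f u" "2 \<le> u"
        using mem_edges_of_iff[OF assms(1) \<open>y < u\<close>] by (auto simp: insert_commute)
      then have "ys \<noteq> []" using path xs by auto
      then have "last ys < u" "{last ys, u} \<in> edges_of n f"
        using sorted path xs by (auto simp: sorted_wrt_append simple_path_def successively_append_iff)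
      then have "last ys = f u" using mem_edges_of_iff[OF assms(1)] by blast
      with yu y xs last_in_set[OF \<open>ys \<noteq> []\<close>] show False by auto
    qed
    moreover have "z \<le> u" if "z \<in> set xs" for z
      using sorted that xs by (auto simp: sorted_wrt_append)
    ultimately show ?thesis using sorted by (fastforce simp: sorted_wrt_append)
  qed simp
qed simp

lemma recursive_tree_edges_of:
  assumes "f \<in> parent_maps n" "n \<ge> 1"
  shows "recursive_tree n (edges_of n f)"
proof -
  have "is_graph {1..n} (edges_of n f)"
    unfolding is_graph_def
  proof
    fix e assume "e \<in> edges_of n f"
    then obtain v where v: "2 \<le> v" "v \<le> n" "e = {f v, v}" by (auto simp: edges_of_def)
    then show "e \<subseteq> {1..n} \<and> card e = 2"
      using parent_maps_bounds[OF assms(1) v(1,2)] by auto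
  qed
  moreover have "same_component (edges_of n f) u v" if "u \<in> {1..n}" "v \<in> {1..n}" for u v
    using same_component_edges_of[OF assms(1)] that by (meson same_component_sym same_component_trans)
  ultimately show ?thesis
    using no_cycle_edges_of[OF assms(1)] sorted_path_edges_of[OF assms(1)] assms(2)
    by (auto simp: recursive_tree_def is_tree_def)
qed

section \<open>From recursive trees back to parent maps\<close>

lemma simple_path_prefix:
  assumes "simple_path E (xs @ ys)" "xs \<noteq> []"
  shows "simple_path E xs"
  using assms by (auto simp: simple_path_def successively_append_iff)

lemma simple_path_suffix:
  assumes "simple_path E (xs @ ys)" "ys \<noteq> []"
  shows "simple_path E ys"
  using assms by (auto simp: simple_path_def successively_append_iff)

lemma simple_path_snoc:
  assumes "simple_path E xs" "{last xs, y} \<in> E" "y \<notin> set xs"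
  shows "simple_path E (xs @ [y])"
  using assms by (auto simp: simple_path_def successively_append_iff)

text \<open>When the walk returns to a vertex of the path built so far, the path is cut off
  there.\<close>

lemma same_component_simple_path:
  assumes "same_component E u v"
  shows "\<exists>xs. simple_path E xs \<and> hd xs = u \<and> last xs = v"
  using assms
proof (induction rule: same_component_induct)
  case refl
  show ?case by (rule exI[of _ "[u]"]) (simp add: simple_path_def)
next
  case (step v w)
  then obtain xs where xs: "simple_path E xs" "hd xs = u" "last xs = v" by blast
  then have "xs \<noteq> []" by (simp add: simple_path_def)
  show ?case
  proof (cases "w \<in> set xs")
    case True
    then obtain as bs where "xs = (as @ [w]) @ bs" by (metis append.assoc append_Cons append_Nil split_list)
    then show ?thesis using xs simple_path_prefix[of E "as @ [w]" bs]
      by (intro exI[of _ "as @ [w]"]) (cases as, auto)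
  next
    case False
    then show ?thesis using xs step simple_path_snoc[of E xs w] \<open>xs \<noteq> []\<close>
      by (intro exI[of _ "xs @ [w]"]) auto
  qed
qed

lemma simple_path_subset:
  assumes "is_graph V E" "simple_path E xs" "hd xs \<in> V"
  shows "set xs \<subseteq> V"
  using assms(2,3)
proof (induction xs rule: rev_induct)
  case (snoc y xs)
  show ?case
  proof (cases "xs = []")
    case True
    with snoc show ?thesis by auto
  next
    case False
    then have "{last xs, y} \<in> E" "simple_path E xs" "hd xs \<in> V"
      using snoc.prems by (auto simp: simple_path_def successively_append_iff)
    then show ?thesis using snoc.IH assms(1) by (auto simp: is_graph_def)
  qed
qed simp

text \<open>If the last vertex is not a leaf, it has a second edge. Its other end is new, as
  otherwise a cycle would close, and a simple path cannot exceed \<open>n\<close> vertices. Length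
  at least 2 keeps the end away from the root, which never counts as a leaf.\<close>

lemma simple_path_extends_to_leaf:
  assumes "is_graph {1..n} E" "\<nexists>xs. simple_cycle E xs"
    and "simple_path E xs" "hd xs = 1" "length xs \<ge> 2" "n \<ge> 1"
  shows "\<exists>ys. simple_path E (xs @ ys) \<and> is_leaf {1..n} E (last (xs @ ys))"
  using assms(3-5)
proof (induction "n - length xs" arbitrary: xs rule: less_induct)
  case less
  obtain as y z where xs: "xs = as @ [y, z]"
    using less.prems(3) by (metis Suc_1 append.assoc append_Cons append_Nil append_butlast_last_id
        butlast.simps(1) le_zero_eq length_0_conv length_butlast list.size(3) diff_is_0_eq
        not_less_eq_eq numeral_2_eq_2)
  have sub: "set xs \<subseteq> {1..n}"
    using simple_path_subset[OF assms(1) less.prems(1)] less.prems(2) assms(6) by simp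
  have dist: "distinct xs" and yz: "{y, z} \<in> E"
    using less.prems(1) xs by (auto simp: simple_path_def successively_append_iff)
  have z1: "z \<noteq> 1" using dist less.prems(2) xs by (cases as) auto
  have fin: "finite E"
  proof (rule finite_subset)
    show "E \<subseteq> Pow {1..n}" using assms(1) by (auto simp: is_graph_def)
  qed simp
  show ?case
  proof (cases "card {e \<in> E. z \<in> e} = 1")
    case True
    then have "is_leaf {1..n} E (last (xs @ []))" using z1 sub xs by (auto simp: is_leaf_def)
    then show ?thesis using less.prems by (intro exI[of _ "[]"]) auto
  next
    case False
    have "{e \<in> E. z \<in> e} \<noteq> {{y, z}}" using False by auto
    then obtain e where e: "e \<in> E" "z \<in> e" "e \<noteq> {y, z}" using yz by blast
    then have "card e = 2" using assms(1) by (auto simp: is_graph_def)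
    then obtain w where w: "e = {z, w}" "w \<noteq> z" using e(2)
      by (metis card_2_iff doubleton_eq_iff insertE singletonD)
    have wy: "w \<noteq> y" using e w by auto
    show ?thesis
    proof (cases "w \<in> set xs")
      case True
      then have "w \<in> set as" using xs w wy by auto
      then obtain bs cs where "as = bs @ w # cs" by (metis split_list)
      then have xs': "xs = bs @ (w # cs @ [y, z])" using xs by simp
      then have "simple_path E (w # cs @ [y, z])" using simple_path_suffix less.prems(1) by blast
      then have "simple_cycle E (w # cs @ [y, z])" using e w by (simp add: simple_cycle_def)
      then show ?thesis using assms(2) by blast
    next
      case wn: False
      have path: "simple_path E (xs @ [w])"
        using less.prems(1) e w wn xs by (intro simple_path_snoc) auto
      have "length (xs @ [w]) \<le> n"
      proof -
        have "hd (xs @ [w]) = 1" using less.prems(2) xs by (cases as) auto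
        then have "set (xs @ [w]) \<subseteq> {1..n}"
          using simple_path_subset[OF assms(1) path] assms(6) by simp
        then have "card (set (xs @ [w])) \<le> card {1..n}" by (rule card_mono[rotated]) simp
        moreover have "card (set (xs @ [w])) = length (xs @ [w])"
          using path by (intro distinct_card) (simp only: simple_path_def)
        ultimately show ?thesis by simp
      qed
      then have "\<exists>ys. simple_path E ((xs @ [w]) @ ys) \<and> is_leaf {1..n} E (last ((xs @ [w]) @ ys))"
        using less.prems path xs by (intro less.hyps) (auto, cases as, auto)
      then show ?thesis by (metis append.assoc)
    qed
  qed
qed

text \<open>The definition only speaks of paths ending in a leaf; longer paths from the root are
  prefixes of such paths, and lists with at most one entry are sorted anyway.\<close>

lemma recursive_tree_path_sorted:
  assumes "recursive_tree n E" "n \<ge> 1" "simple_path E xs" "hd xs = 1"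
  shows "sorted_wrt (<) xs"
proof (cases "length xs \<ge> 2")
  case True
  have "is_graph {1..n} E" "\<nexists>xs. simple_cycle E xs"
    using assms(1) by (auto simp: recursive_tree_def is_tree_def)
  then obtain ys where ys: "simple_path E (xs @ ys)" "is_leaf {1..n} E (last (xs @ ys))"
    using simple_path_extends_to_leaf assms(2-4) True by metis
  have "xs \<noteq> []" using True by auto
  then have "hd (xs @ ys) = 1" using assms(4) by simp
  then have "sorted_wrt (<) (xs @ ys)" using assms(1) ys unfolding recursive_tree_def by blast
  then show ?thesis by (simp add: sorted_wrt_append)
next
  case False
  then have "length xs = 0 \<or> length xs = 1" by linarith
  then show ?thesis by (auto simp: length_Suc_conv)
qed

text \<open>If \<open>v\<close> had two smaller neighbours \<open>a\<close> and \<open>b\<close>, then following a path from \<open>1\<close> to \<open>a\<close> by \<open>v\<close>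
  and \<open>b\<close> would either produce an unsorted path or close a cycle.\<close>

lemma recursive_tree_unique_parent:
  assumes "recursive_tree n E" "v \<in> {2..n}"
  shows "\<exists>!u. u < v \<and> {u, v} \<in> E"
proof -
  have n: "n \<ge> 1" using assms(2) by auto
  have graph: "is_graph {1..n} E" and nocyc: "\<nexists>xs. simple_cycle E xs"
    and conn: "\<And>u v. u \<in> {1..n} \<Longrightarrow> v \<in> {1..n} \<Longrightarrow> same_component E u v"
    using assms(1) by (auto simp: recursive_tree_def is_tree_def)
  note sorted = recursive_tree_path_sorted[OF assms(1) n]
  show ?thesis
  proof (rule ex_ex1I)
    obtain xs where xs: "simple_path E xs" "hd xs = 1" "last xs = v"
      using same_component_simple_path conn[of 1 v] assms(2) by fastforce
    then have "xs \<noteq> []" by (simp add: simple_path_def)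
    then obtain ys where ys: "xs = ys @ [v]" using xs(3) by (metis append_butlast_last_id)
    then have "ys \<noteq> []" using xs(2) assms(2) by auto
    then have "last ys < v \<and> {last ys, v} \<in> E"
      using sorted[OF xs(1,2)] xs(1) ys
      by (auto simp: sorted_wrt_append simple_path_def successively_append_iff)
    then show "\<exists>u. u < v \<and> {u, v} \<in> E" by blast
  next
    fix a b assume a: "a < v \<and> {a, v} \<in> E" and b: "b < v \<and> {b, v} \<in> E"
    have "a \<in> {1..n}" using a graph by (auto simp: is_graph_def)
    then obtain xs where xs: "simple_path E xs" "hd xs = 1" "last xs = a"
      using same_component_simple_path conn[of 1 a] n by fastforce
    have ne: "xs \<noteq> []" using xs by (simp add: simple_path_def)
    then obtain zs where zs: "xs = zs @ [a]" using xs by (metis append_butlast_last_id)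
    \<comment> \<open>The path is increasing and ends in \<open>a < v\<close>, so it has not yet met
      \<open>v\<close>.\<close>
    have "v \<notin> set xs" using sorted[OF xs(1,2)] a zs by (auto simp: sorted_wrt_append)
    then have path: "simple_path E (xs @ [v])" using xs a by (intro simple_path_snoc) auto
    show "a = b"
    proof (rule ccontr)
      assume "a \<noteq> b"
      show False
      proof (cases "b \<in> set xs")
        case True
        then have "b \<in> set zs" using zs \<open>a \<noteq> b\<close> by auto
        then obtain as bs where "zs = as @ b # bs" by (metis split_list)
        then have "xs @ [v] = as @ (b # bs @ [a, v])" using zs by simp
        then have "simple_path E (b # bs @ [a, v])" using path simple_path_suffix by (metis list.discI)
        then have "simple_cycle E (b # bs @ [a, v])"
          using b by (simp add: simple_cycle_def insert_commute)
        then show False using nocyc by blast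
      next
        case False
        then have "simple_path E ((xs @ [v]) @ [b])"
          using path b by (intro simple_path_snoc[OF path]) (auto simp: insert_commute)
        then have "sorted_wrt (<) ((xs @ [v]) @ [b])" using ne xs by (intro sorted) auto
        then show False using b by (auto simp: sorted_wrt_append)
      qed
    qed
  qed
qed

text \<open>The parent of a vertex is its unique smaller neighbour. Together with
  \<open>inj_on_edges_of\<close> this turns the random recursive tree into a uniform parent map,
  that is, independent uniform choices of parents.\<close>

lemma recursive_trees_eq:
  assumes "n \<ge> 1"
  shows "{E. recursive_tree n E} = edges_of n ` parent_maps n"
proof (intro equalityI subsetI)
  fix E assume "E \<in> edges_of n ` parent_maps n"
  then show "E \<in> {E. recursive_tree n E}" using recursive_tree_edges_of assms by auto
next
  fix E assume "E \<in> {E. recursive_tree n E}"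
  then have E: "recursive_tree n E" by simp
  then have graph: "is_graph {1..n} E" by (auto simp: recursive_tree_def is_tree_def)
  define f where "f = (\<lambda>v\<in>{2..n}. THE u. u < v \<and> {u, v} \<in> E)"
  have f: "f v < v" "{f v, v} \<in> E" if "v \<in> {2..n}" for v
    using theI'[OF recursive_tree_unique_parent[OF E that]] that by (auto simp: f_def)
  have f_eq: "u = f v" if "v \<in> {2..n}" "u < v" "{u, v} \<in> E" for u v
    using recursive_tree_unique_parent[OF E that(1)] f[OF that(1)] that by blast
  have "f v \<in> {1..<v}" if "v \<in> {2..n}" for v
  proof -
    have "{f v, v} \<subseteq> {1..n}" using f(2)[OF that] graph by (auto simp: is_graph_def)
    then show ?thesis using f(1)[OF that] by auto
  qed
  then have "f \<in> parent_maps n" by (auto simp: parent_maps_def f_def)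
  moreover have "E = edges_of n f"
  proof (intro equalityI subsetI)
    fix e assume e: "e \<in> E"
    then have "card e = 2" "e \<subseteq> {1..n}" using graph by (auto simp: is_graph_def)
    then obtain a b where ab: "e = {a, b}" "a \<noteq> b" "a \<in> {1..n}" "b \<in> {1..n}"
      by (auto simp: card_2_iff)
    define u v where "u = min a b" and "v = max a b"
    have uv: "e = {u, v}" "u < v" "v \<in> {2..n}"
      using ab by (auto simp: u_def v_def min_def max_def)
    then have "u = f v" using f_eq e by blast
    then show "e \<in> edges_of n f" using uv by (auto simp: edges_of_def)
  qed (use f in \<open>auto simp: edges_of_def\<close>)
  ultimately show "E \<in> edges_of n ` parent_maps n" by blast
qed

section \<open>Ancestors and edges examined first\<close>

text \<open>The vertices of the path from \<open>v\<close> to the root, both included. The test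
  \<open>f v < v\<close> makes the recursion terminate for arbitrary \<open>f\<close>.\<close>

fun ancestors :: "(nat \<Rightarrow> nat) \<Rightarrow> nat \<Rightarrow> nat set" where
  "ancestors f v = (if 2 \<le> v \<and> f v < v then insert v (ancestors f (f v)) else {v})"

declare ancestors.simps [simp del]

text \<open>The edges above these vertices are the ones a fire from the edge above \<open>v\<close>
  must cross to meet the path from \<open>1\<close> to \<open>w\<close>. Inserting \<open>v\<close>
  keeps its own edge when \<open>v\<close> already lies on that path.\<close>

definition branch :: "(nat \<Rightarrow> nat) \<Rightarrow> nat \<Rightarrow> nat \<Rightarrow> nat set" where
  "branch f v w = insert v (ancestors f v - ancestors f w)"

text \<open>The distance from \<open>v\<close> to the path from \<open>1\<close> to
  \<open>w\<close>, not symmetric in \<open>v\<close> and \<open>w\<close>. It is \<open>0\<close>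
  on the path, where the branch still has one edge; hence the later \<open>max 1\<close>.\<close>

definition gap :: "(nat \<Rightarrow> nat) \<Rightarrow> nat \<Rightarrow> nat \<Rightarrow> nat" where
  "gap f v w = card (ancestors f v - ancestors f w)"

lemma ancestors_1 [simp]: "ancestors f (Suc 0) = {1}"
  by (subst ancestors.simps) auto

lemma self_in_ancestors [simp]: "v \<in> ancestors f v"
  by (subst ancestors.simps) auto

lemma finite_ancestors [simp]: "finite (ancestors f v)"
proof (induction f v rule: ancestors.induct)
  case (1 f v)
  then show ?case by (subst ancestors.simps) auto
qed

lemma ancestors_insert: "2 \<le> v \<Longrightarrow> f v < v \<Longrightarrow> ancestors f v = insert v (ancestors f (f v))"
  by (subst ancestors.simps) simp

lemma ancestors_step:
  assumes "f \<in> parent_maps n" "v \<in> {2..n}"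
  shows "ancestors f v = insert v (ancestors f (f v))"
  using assms parent_maps_bounds[OF assms(1), of v] by (intro ancestors_insert) auto

lemma ancestors_parent_closed: "u \<in> ancestors f v \<Longrightarrow> 2 \<le> u \<Longrightarrow> f u < u \<Longrightarrow> f u \<in> ancestors f v"
proof (induction f v rule: ancestors.induct)
  case (1 f v)
  then show ?case by (subst ancestors.simps, subst (asm) (3) ancestors.simps) (auto split: if_splits)
qed

lemma ancestors_le: "u \<in> ancestors f v \<Longrightarrow> u \<le> v"
proof (induction f v rule: ancestors.induct)
  case (1 f v)
  then show ?case by (subst (asm) (2) ancestors.simps) (auto split: if_splits)
qed

lemma ancestors_mono: "u \<in> ancestors f v \<Longrightarrow> ancestors f u \<subseteq> ancestors f v"
proof (induction f v rule: ancestors.induct)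
  case (1 f v)
  show ?case
  proof (cases "u = v")
    case False
    then have "2 \<le> v \<and> f v < v" "u \<in> ancestors f (f v)"
      using 1(2) by (subst (asm) ancestors.simps, auto split: if_splits)+
    then show ?thesis using 1(1) by (subst (2) ancestors.simps) auto
  qed simp
qed

lemma ancestors_props:
  assumes "f \<in> parent_maps n" "v \<in> {1..n}"
  shows "1 \<in> ancestors f v \<and> ancestors f v \<subseteq> {1..n}"
  using assms(2)
proof (induction v rule: less_induct)
  case (less v)
  show ?case
  proof (cases "v = 1")
    case True
    then show ?thesis using less.prems by simp
  next
    case False
    then have v: "v \<in> {2..n}" using less.prems by auto
    then have "f v < v" "f v \<in> {1..n}" using parent_maps_bounds[OF assms(1), of v] by auto
    then show ?thesis using less.IH[of "f v"] less.prems ancestors_step[OF assms(1) v] by auto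
  qed
qed

lemma ancestors_fun_upd:
  assumes "f \<in> parent_maps n" "v \<in> {1..n}"
  shows "ancestors (f(Suc n := j)) v = ancestors f v"
  using assms(2)
proof (induction v rule: less_induct)
  case (less v)
  show ?case
  proof (cases "v = 1")
    case False
    then have v: "v \<in> {2..n}" using less.prems by auto
    then have "f v < v" "f v \<in> {1..n}" using parent_maps_bounds[OF assms(1), of v] by auto
    moreover have upd: "(f(Suc n := j)) v = f v" using v by simp
    ultimately have "ancestors (f(Suc n := j)) v = insert v (ancestors (f(Suc n := j)) (f v))"
      using v ancestors_insert[of v "f(Suc n := j)"] by simp
    also have "\<dots> = ancestors f v"
      using less.IH[of "f v"] \<open>f v < v\<close> \<open>f v \<in> {1..n}\<close> ancestors_step[OF assms(1) v] by metis
    finally show ?thesis .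
  qed simp
qed

lemma ancestors_fun_upd_new:
  assumes "f \<in> parent_maps n" "j \<in> {1..n}"
  shows "ancestors (f(Suc n := j)) (Suc n) = insert (Suc n) (ancestors f j)"
  using assms ancestors_fun_upd[OF assms] by (subst ancestors.simps) auto

text \<open>The new vertex is no ancestor of an old one. So as a target it acts like its parent
  \<open>j\<close>, and as a source it lies one edge further away than \<open>j\<close>.\<close>

lemma gap_fun_upd:
  assumes "f \<in> parent_maps n" "j \<in> {1..n}" "v \<in> {1..n}" "w \<in> {1..n}"
  shows "gap (f(Suc n := j)) v w = gap f v w"
    and "gap (f(Suc n := j)) v (Suc n) = gap f v j"
    and "gap (f(Suc n := j)) (Suc n) w = Suc (gap f j w)"
proof -
  have *: "Suc n \<notin> ancestors f u" if "u \<in> {1..n}" for u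
    using ancestors_le[of "Suc n" f u] that by auto
  have 1: "ancestors f v - insert (Suc n) (ancestors f j) = ancestors f v - ancestors f j"
    using *[OF assms(3)] by auto
  have 2: "insert (Suc n) (ancestors f j) - ancestors f w = insert (Suc n) (ancestors f j - ancestors f w)"
    using *[OF assms(4)] by auto
  show "gap (f(Suc n := j)) v w = gap f v w"
    and "gap (f(Suc n := j)) v (Suc n) = gap f v j"
    and "gap (f(Suc n := j)) (Suc n) w = Suc (gap f j w)"
    unfolding gap_def using assms *[OF assms(2)]
    by (simp_all add: ancestors_fun_upd ancestors_fun_upd_new 1 2)
qed

lemma gap_self [simp]: "gap f v v = 0"
  by (simp add: gap_def)

lemma card_branch: "card (branch f v w) = max 1 (gap f v w)"
proof (cases "v \<in> ancestors f w")
  case True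
  then have "ancestors f v - ancestors f w = {}" using ancestors_mono by blast
  then show ?thesis unfolding branch_def gap_def by (simp only:) simp
next
  case False
  then have "branch f v w = ancestors f v - ancestors f w" by (auto simp: branch_def)
  moreover have "v \<in> ancestors f v - ancestors f w" using False by simp
  then have "card (ancestors f v - ancestors f w) > 0"
    by (metis card_gt_0_iff empty_iff finite_Diff finite_ancestors)
  ultimately show ?thesis by (simp add: gap_def)
qed

lemma branch_subset:
  assumes "f \<in> parent_maps n" "v \<in> {2..n}" "w \<in> {1..n}"
  shows "branch f v w \<subseteq> {2..n}"
proof
  fix u assume u: "u \<in> branch f v w"
  then have "u \<in> ancestors f v" by (auto simp: branch_def)
  moreover have "u \<noteq> 1" using u ancestors_props[OF assms(1,3)] assms(2) by (auto simp: branch_def)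
  ultimately show "u \<in> {2..n}" using ancestors_props[OF assms(1), of v] assms(2) by fastforce
qed

definition edge_above :: "(nat \<Rightarrow> nat) \<Rightarrow> nat \<Rightarrow> nat set" where
  "edge_above f v = {f v, v}"

lemma edges_of_eq: "edges_of n f = edge_above f ` {2..n}"
  by (simp add: edges_of_def edge_above_def)

lemma inj_on_edge_above: "f \<in> parent_maps n \<Longrightarrow> inj_on (edge_above f) {2..n}"
  using inj_on_edge by (simp add: edge_above_def[abs_def])

text \<open>In a tree the only way from \<open>v\<close> to the path of \<open>w\<close> is up the
  branch. Formally, touching edges above \<open>u\<close> and \<open>v\<close> satisfy
  \<open>branch f v w \<subseteq> insert v (branch f u w)\<close>, so a detour never shortens the
  list of edges required.\<close>

lemma edge_reached_iff:
  assumes "f \<in> parent_maps n" "v \<in> {2..n}" "w \<in> {1..n}" "R \<subseteq> edges_of n f"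
  shows "edge_above f v \<in> edges_reached (ancestors f w) R \<longleftrightarrow> edge_above f ` branch f v w \<subseteq> R"
proof
  have reached: "edge_above f ` branch f v w \<subseteq> R"
    if "e \<in> edges_reached (ancestors f w) R" "v \<in> {2..n}" "e = edge_above f v" for e v
    using that
  proof (induction arbitrary: v)
    case (touch e)
    have fv: "f v < v" using parent_maps_bounds[OF assms(1)] touch.prems by auto
    have "f v \<in> ancestors f w"
      using touch ancestors_parent_closed[of v f w] fv by (auto simp: edge_above_def)
    then have "ancestors f (f v) \<subseteq> ancestors f w" by (rule ancestors_mono)
    then have "branch f v w = {v}"
      using ancestors_step[OF assms(1) touch.prems(1)] by (auto simp: branch_def)
    then show ?case using touch by simp
  next
    case (step g e)
    have "g \<in> R" using step.hyps(1) edges_reached_subset by blast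
    then obtain u where u: "u \<in> {2..n}" "g = edge_above f u"
      using assms(4) by (auto simp: edges_of_eq)
    have "f v = u \<or> v = f u \<or> f v = f u \<or> v = u"
      using step.hyps(3) step.prems u by (auto simp: edge_above_def)
    then have "branch f v w \<subseteq> insert v (branch f u w)"
      using ancestors_step[OF assms(1) u(1)] ancestors_step[OF assms(1) step.prems(1)]
      by (auto simp: branch_def)
    then show ?case using step.IH[OF u] step.hyps(2) step.prems by blast
  qed
  show "edge_above f ` branch f v w \<subseteq> R" if "edge_above f v \<in> edges_reached (ancestors f w) R"
    using reached[OF that assms(2)] by simp
  show "edge_above f v \<in> edges_reached (ancestors f w) R" if "edge_above f ` branch f v w \<subseteq> R"
    using assms(2) that
  proof (induction v rule: less_induct)
    case (less v)
    have fv: "f v < v" "1 \<le> f v" using parent_maps_bounds[OF assms(1)] less.prems(1) by auto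
    have eR: "edge_above f v \<in> R" using less.prems(2) by (auto simp: branch_def)
    show ?case
    proof (cases "f v \<in> ancestors f w")
      case True
      then show ?thesis using eR by (intro edges_reached.touch) (auto simp: edge_above_def)
    next
      case False
      then have "f v \<noteq> 1" using ancestors_props[OF assms(1,3)] by auto
      then have fv2: "f v \<in> {2..n}" using fv less.prems(1) by auto
      have "branch f (f v) w \<subseteq> branch f v w"
        using ancestors_step[OF assms(1) less.prems(1)] False by (auto simp: branch_def)
      then have "edge_above f (f v) \<in> edges_reached (ancestors f w) R"
        using less.IH[OF fv(1) fv2] less.prems(2) by blast
      then show ?thesis using eR by (rule edges_reached.step) (auto simp: edge_above_def)
    qed
  qed
qed

section \<open>The first edge of a set in a uniformly random order\<close>

definition first_in :: "'a set \<Rightarrow> 'a list \<Rightarrow> 'a" where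
  "first_in F es = hd (filter (\<lambda>x. x \<in> F) es)"

text \<open>Rephrases that \<open>F\<close> is still unexamined when \<open>e\<close> comes up as a
  property of the order that symmetry can handle.\<close>

lemma first_in_eq_iff:
  assumes "distinct es" "F \<subseteq> set es" "e \<in> F"
  shows "first_in F es = e \<longleftrightarrow> F \<subseteq> set (dropWhile (\<lambda>x. x \<noteq> e) es)"
proof -
  obtain as bs where es: "es = as @ e # bs" using assms by (metis split_list subsetD)
  have "e \<notin> set as" using es assms(1) by auto
  then have "dropWhile (\<lambda>x. x \<noteq> e) es = e # bs" unfolding es by (subst dropWhile_append2) auto
  moreover have "F \<subseteq> set (e # bs) \<longleftrightarrow> set as \<inter> F = {}"
    using assms es by auto
  moreover have "first_in F es = e \<longleftrightarrow> set as \<inter> F = {}"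
  proof (cases "filter (\<lambda>x. x \<in> F) as")
    case Nil
    then show ?thesis using assms(3) es by (auto simp: first_in_def filter_empty_conv)
  next
    case (Cons a xs)
    then have "a \<in> set (filter (\<lambda>x. x \<in> F) as)" by simp
    then have "a \<in> set as \<inter> F" by simp
    moreover from this have "a \<noteq> e" using \<open>e \<notin> set as\<close> by auto
    moreover have "first_in F es = a" using Cons es by (simp add: first_in_def)
    ultimately show ?thesis by auto
  qed
  ultimately show ?thesis by simp
qed

lemma first_in_mem:
  assumes "F \<subseteq> set es" "F \<noteq> {}"
  shows "first_in F es \<in> F"
proof -
  have "filter (\<lambda>x. x \<in> F) es \<noteq> []" using assms by (auto simp: filter_empty_conv)
  then have "first_in F es \<in> set (filter (\<lambda>x. x \<in> F) es)" unfolding first_in_def by (rule hd_in_set)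
  then show ?thesis by simp
qed

lemma first_in_mono:
  assumes "distinct es" "F \<subseteq> set es" "first_in F es \<in> G" "G \<subseteq> F"
  shows "first_in G es = first_in F es"
  using assms first_in_eq_iff[of es F "first_in F es"] first_in_eq_iff[of es G "first_in F es"]
  by (meson order_trans subsetD)

lemma first_in_map:
  assumes "inj \<pi>" "\<pi> ` F = F" "F \<subseteq> set es" "F \<noteq> {}"
  shows "first_in F (map \<pi> es) = \<pi> (first_in F es)"
proof -
  have "\<pi> x \<in> F \<longleftrightarrow> x \<in> F" for x using assms(1,2) by (metis inj_image_mem_iff)
  moreover have "filter (\<lambda>x. x \<in> F) es \<noteq> []" using assms(3,4) by (auto simp: filter_empty_conv)
  ultimately show ?thesis by (simp add: first_in_def filter_map o_def hd_map)
qed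

text \<open>By \<open>edge_reached_iff\<close>, the edge above \<open>v\<close> is a hit iff its
  whole branch is unexamined when its turn comes.\<close>

lemma hits_eq_first:
  assumes "f \<in> parent_maps n" "w \<in> {1..n}" "es \<in> permutations_of_set (edges_of n f)"
  shows "hits (ancestors f w) es =
    (\<Sum>v\<in>{2..n}. of_bool (first_in (edge_above f ` branch f v w) es = edge_above f v))"
proof -
  have es: "distinct es" "set es = edges_of n f" using permutations_of_setD[OF assms(3)] by auto
  have "hits (ancestors f w) es = (\<Sum>v\<in>{2..n}. of_bool (edge_above f v \<in>
      edges_reached (ancestors f w) (set (dropWhile (\<lambda>x. x \<noteq> edge_above f v) es))))"
    unfolding hits_eq_sum[OF es(1)] es(2) unfolding edges_of_eq
    by (subst sum.reindex) (auto simp: inj_on_edge_above[OF assms(1)])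
  also have "\<dots> = (\<Sum>v\<in>{2..n}. of_bool (first_in (edge_above f ` branch f v w) es = edge_above f v))"
  proof (rule sum.cong[OF refl], rule arg_cong[where f = of_bool])
    fix v assume v: "v \<in> {2..n}"
    have "edge_above f ` branch f v w \<subseteq> set es"
      using branch_subset[OF assms(1) v assms(2)] es by (auto simp: edges_of_eq)
    moreover have "edge_above f v \<in> edge_above f ` branch f v w" by (auto simp: branch_def)
    moreover have "set (dropWhile (\<lambda>x. x \<noteq> edge_above f v) es) \<subseteq> edges_of n f"
      using es by (metis set_dropWhileD subsetI)
    ultimately show "edge_above f v \<in> edges_reached (ancestors f w) (set (dropWhile (\<lambda>x. x \<noteq> edge_above f v) es))
      \<longleftrightarrow> first_in (edge_above f ` branch f v w) es = edge_above f v"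
      using edge_reached_iff[OF assms(1) v assms(2)] first_in_eq_iff[OF es(1)] by simp
  qed
  finally show ?thesis .
qed

lemma card_uniform_fibres:
  assumes "finite A" "finite B" "g ` A \<subseteq> B" "\<And>b. b \<in> B \<Longrightarrow> card {a \<in> A. g a = b} = m"
  shows "card A = card B * m"
proof -
  have "card A = (\<Sum>b\<in>B. card {a \<in> A. g a = b})"
    using sum.group[OF assms(1-3), of "\<lambda>_. 1 :: nat"] by simp
  then show ?thesis using assms(4) by simp
qed

lemma map_permutes_permutations:
  assumes "\<pi> permutes E" "es \<in> permutations_of_set E"
  shows "map \<pi> es \<in> permutations_of_set E"
  using permutations_of_set_image_permutes[OF assms(1)] assms(2) by blast

text \<open>Transposing two elements of \<open>F\<close> maps the orders in which one comes first to
  those in which the other does. So each has probability \<open>1 / card F\<close>, written here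
  without division.\<close>

lemma card_first_in:
  assumes "finite E" "F \<subseteq> E" "a \<in> F"
  shows "card F * card {es \<in> permutations_of_set E. first_in F es = a} = card (permutations_of_set E)"
proof -
  let ?P = "permutations_of_set E"
  have le: "card {es \<in> ?P. first_in F es = b} \<le> card {es \<in> ?P. first_in F es = c}"
    if "b \<in> F" "c \<in> F" for b c
  proof (rule card_inj_on_le)
    let ?\<pi> = "Transposition.transpose b c"
    show "inj_on (map ?\<pi>) {es \<in> ?P. first_in F es = b}"
      by (intro inj_on_subset[OF inj_mapI]) auto
    have "?\<pi> permutes E" using that assms by (intro permutes_swap_id) auto
    moreover have "?\<pi> ` F = F" using that by (simp add: transpose_image_eq)
    ultimately have "map ?\<pi> es \<in> ?P \<and> first_in F (map ?\<pi> es) = ?\<pi> (first_in F es)" if "es \<in> ?P" for es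
      using that assms map_permutes_permutations first_in_map[of ?\<pi> F es] permutations_of_setD(1)[OF that]
      by auto
    then show "map ?\<pi> ` {es \<in> ?P. first_in F es = b} \<subseteq> {es \<in> ?P. first_in F es = c}"
      by auto
  qed auto
  show ?thesis
  proof (rule card_uniform_fibres[symmetric, where g = "first_in F"])
    show "card {es \<in> ?P. first_in F es = b} = card {es \<in> ?P. first_in F es = a}" if "b \<in> F" for b
      using le[OF that assms(3)] le[OF assms(3) that] by simp
    show "first_in F ` ?P \<subseteq> F"
      using assms by (auto intro!: first_in_mem dest: permutations_of_setD(1))
  qed (use assms in \<open>auto intro: finite_subset\<close>)
qed

text \<open>Independence for disjoint sets, again by symmetry: one transposition inside
  \<open>F\<close> and one inside \<open>G\<close> carry any pair of first elements to any
  other.\<close>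

lemma card_first_in_both:
  assumes "finite E" "F \<subseteq> E" "G \<subseteq> E" "F \<inter> G = {}" "a \<in> F" "b \<in> G"
  shows "card F * card G * card {es \<in> permutations_of_set E. first_in F es = a \<and> first_in G es = b} =
    card (permutations_of_set E)"
proof -
  let ?P = "permutations_of_set E"
  have le: "card {es \<in> ?P. first_in F es = b \<and> first_in G es = d} \<le>
      card {es \<in> ?P. first_in F es = c \<and> first_in G es = e}"
    if "b \<in> F" "c \<in> F" "d \<in> G" "e \<in> G" for b c d e
  proof (rule card_inj_on_le)
    let ?\<pi> = "Transposition.transpose b c \<circ> Transposition.transpose d e"
    have inj: "inj ?\<pi>" by (intro inj_compose) auto
    then show "inj_on (map ?\<pi>) {es \<in> ?P. first_in F es = b \<and> first_in G es = d}"
      by (intro inj_on_subset[OF inj_mapI]) auto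
    have \<pi>: "?\<pi> permutes E" using that assms by (intro permutes_compose permutes_swap_id) auto
    \<comment> \<open>By disjointness each transposition fixes the other set pointwise.\<close>
    have "b \<notin> G" "c \<notin> G" "d \<notin> F" "e \<notin> F" using that assms(4) by auto
    then have img: "?\<pi> ` F = F" "?\<pi> ` G = G"
      using that unfolding image_comp[symmetric] by (simp_all add: transpose_image_eq)
    have val: "?\<pi> b = c" "?\<pi> d = e"
      using that assms(4) by (auto simp: Transposition.transpose_def)
    show "map ?\<pi> ` {es \<in> ?P. first_in F es = b \<and> first_in G es = d} \<subseteq>
        {es \<in> ?P. first_in F es = c \<and> first_in G es = e}"
    proof (rule image_subsetI)
      fix es assume es: "es \<in> {es \<in> ?P. first_in F es = b \<and> first_in G es = d}"
      then have "set es = E" by (auto dest: permutations_of_setD)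
      then have "first_in F (map ?\<pi> es) = c" "first_in G (map ?\<pi> es) = e"
        using first_in_map[OF inj img(1), of es] first_in_map[OF inj img(2), of es] es val assms by auto
      then show "map ?\<pi> es \<in> {es \<in> ?P. first_in F es = c \<and> first_in G es = e}"
        using es \<pi> map_permutes_permutations by blast
    qed
  qed auto
  let ?g = "\<lambda>es. (first_in F es, first_in G es)"
  have "card ?P = card (F \<times> G) * card {es \<in> ?P. first_in F es = a \<and> first_in G es = b}"
  proof (rule card_uniform_fibres[where g = ?g])
    show "card {es \<in> ?P. ?g es = x} = card {es \<in> ?P. first_in F es = a \<and> first_in G es = b}"
      if x: "x \<in> F \<times> G" for x
      using le[of "fst x" a "snd x" b] le[of a "fst x" b "snd x"] assms x
      by (cases x) auto
    show "?g ` ?P \<subseteq> F \<times> G"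
      using assms by (auto intro!: first_in_mem dest: permutations_of_setD(1))
  qed (use assms in \<open>auto intro: finite_subset\<close>)
  then show ?thesis by (simp add: card_cartesian_product)
qed

section \<open>Averages over recursive trees\<close>

text \<open>A walk from \<open>1\<close> collects all ancestors of the vertices it visits, which
  gives one direction. Conversely, edges between fireproof ancestors are kept, and the kept
  component of a fireproof vertex is entirely fireproof.\<close>

lemma fireproof_subtree_iff:
  assumes f: "f \<in> parent_maps n" and X: "X \<in> {1..n}"
  shows "(\<exists>C \<in> fireproof_subtrees {1..n} (edges_of n f) s. X \<in> C \<and> 1 \<in> C) \<longleftrightarrow>
    (\<forall>v\<in>ancestors f X. fireproof_vertex (edges_of n f) s v)"
proof
  let ?E = "edges_of n f"
  let ?R = "remaining_edges ?E s"
  have RE: "?R \<subseteq> ?E" by (auto simp: remaining_edges_def)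
  have n: "1 \<in> {1..n}" using X by auto
  {
    assume "\<exists>C \<in> fireproof_subtrees {1..n} ?E s. X \<in> C \<and> 1 \<in> C"
    then obtain u where comp: "same_component ?R u X" "same_component ?R u 1"
      and fproof: "\<And>v. v \<in> {1..n} \<Longrightarrow> same_component ?R u v \<Longrightarrow> fireproof_vertex ?E s v"
      by (auto simp: fireproof_subtrees_def components_of_def)
    have "same_component ?R 1 X" using comp same_component_sym same_component_trans by metis
    then have "\<forall>v\<in>ancestors f X. same_component ?R 1 v"
    proof (induction rule: same_component_induct)
      case (step v w)
      then have "{v, w} \<in> ?E" using RE by blast
      then obtain x where x: "x \<in> {2..n}" "{v, w} = {f x, x}" by (auto simp: edges_of_def)
      have "same_component ?R 1 w" using step by (meson same_component_edge same_component_trans)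
      then show ?case
        using x step ancestors_step[OF f x(1)] by (auto simp: doubleton_eq_iff)
    qed simp
    moreover have "ancestors f X \<subseteq> {1..n}" using ancestors_props[OF f X] by blast
    ultimately show "\<forall>v\<in>ancestors f X. fireproof_vertex ?E s v"
      using fproof comp same_component_trans by blast
  }
  {
    assume fp: "\<forall>v\<in>ancestors f X. fireproof_vertex ?E s v"
    let ?C = "{v \<in> {1..n}. same_component ?R 1 v}"
    have "\<forall>v\<in>ancestors f X. fireproof_vertex ?E s v \<Longrightarrow> same_component ?R 1 X"
      using X
    proof (induction X rule: less_induct)
      case (less v)
      show ?case
      proof (cases "v = 1")
        case False
        then have v: "v \<in> {2..n}" using less.prems by auto
        have fv: "f v < v" "1 \<le> f v" using parent_maps_bounds[OF f] v by auto
        have anc: "ancestors f v = insert v (ancestors f (f v))" by (rule ancestors_step[OF f v])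
        have "{f v, v} \<in> ?R"
          using less.prems(1) v by (auto simp: remaining_edges_def edges_of_def anc)
        moreover have "same_component ?R 1 (f v)"
          using less.IH[OF fv(1)] less.prems fv anc v by auto
        ultimately show ?thesis by (meson same_component_edge same_component_trans)
      qed simp
    qed
    then have "X \<in> ?C" using X fp by simp
    moreover have "1 \<in> ?C" using n by simp
    \<comment> \<open>An edge at a fireproof vertex is fireproof, and such an edge is kept only if
      its other end is fireproof as well.\<close>
    moreover have "fireproof_vertex ?E s v" if "same_component ?R 1 v" for v
      using that
    proof (induction rule: same_component_induct)
      case refl
      then show ?case using fp ancestors_props[OF f X] by auto
    next
      case (step v w)
      then have "{v, w} \<in> ?E" "s {v, w} = Fireproof" using RE by (auto simp: fireproof_vertex_def)
      then show ?case using step.hyps by (auto simp: remaining_edges_def)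
    qed
    ultimately show "\<exists>C \<in> fireproof_subtrees {1..n} ?E s. X \<in> C \<and> 1 \<in> C"
      using n by (intro bexI[of _ ?C]) (auto simp: fireproof_subtrees_def components_of_def)
  }
qed

section \<open>Uniform averages and the law of the model\<close>

text \<open>Expectation under the uniform law as a finite sum, so that linearity and exchange of
  averages need no integrability conditions.\<close>

definition avg :: "'a set \<Rightarrow> ('a \<Rightarrow> real) \<Rightarrow> real" where
  "avg A g = sum g A / real (card A)"

lemma avg_cong: "(\<And>a. a \<in> A \<Longrightarrow> g a = h a) \<Longrightarrow> avg A g = avg A h"
  by (simp add: avg_def)

lemma avg_mono: "(\<And>a. a \<in> A \<Longrightarrow> g a \<le> h a) \<Longrightarrow> avg A g \<le> avg A h"
  by (auto simp: avg_def intro!: divide_right_mono sum_mono)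

lemma avg_add: "avg A (\<lambda>a. g a + h a) = avg A g + avg A h"
  by (simp add: avg_def sum.distrib add_divide_distrib)

lemma avg_diff: "avg A (\<lambda>a. g a - h a) = avg A g - avg A h"
  by (simp add: avg_def sum_subtractf diff_divide_distrib)

lemma avg_cmult: "avg A (\<lambda>a. c * g a) = c * avg A g"
  by (simp add: avg_def sum_distrib_left[symmetric])

lemma avg_sum: "avg A (\<lambda>a. \<Sum>i\<in>I. g i a) = (\<Sum>i\<in>I. avg A (g i))"
  by (simp add: avg_def sum.swap[of _ I] sum_divide_distrib)

lemma avg_const: "finite A \<Longrightarrow> A \<noteq> {} \<Longrightarrow> avg A (\<lambda>_. c) = c"
  by (simp add: avg_def)

lemma avg_swap: "avg A (\<lambda>a. avg B (\<lambda>b. g a b)) = avg B (\<lambda>b. avg A (\<lambda>a. g a b))"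
  by (simp add: avg_def sum_divide_distrib[symmetric] sum.swap[of _ B] mult.commute)

lemma expectation_pmf_of_set:
  "finite A \<Longrightarrow> A \<noteq> {} \<Longrightarrow> measure_pmf.expectation (pmf_of_set A) g = avg A g"
  by (simp add: integral_pmf_of_set avg_def)

lemma finite_parent_maps [simp]: "finite (parent_maps n)"
  by (simp add: parent_maps_def finite_PiE)

lemma parent_maps_nonempty [simp]: "parent_maps n \<noteq> {}"
  by (auto simp: parent_maps_def PiE_eq_empty_iff)

lemma finite_edges_of [simp]: "finite (edges_of n f)"
  by (simp add: edges_of_def)

lemma fire_model_prob:
  assumes "n \<ge> 1" "0 \<le> p" "p \<le> 1"
  shows "measure_pmf.prob (fire_model n p) {((T, s), X). \<exists>C \<in> fireproof_subtrees {1..n} T s. X \<in> C \<and> 1 \<in> C} =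
    avg {1..n} (\<lambda>X. avg (parent_maps n) (\<lambda>f. avg (permutations_of_set (edges_of n f))
      (\<lambda>es. (1 - p) ^ hits (ancestors f X) es)))"
    (is "measure_pmf.prob _ ?A = _")
proof -
  have rrt: "random_recursive_tree n = map_pmf (edges_of n) (pmf_of_set (parent_maps n))"
    by (simp add: random_recursive_tree_def recursive_trees_eq[OF assms(1)] map_pmf_of_set_inj
        inj_on_edges_of)
  \<comment> \<open>By independence the vertex \<open>X\<close> may be drawn first, so that the
    fires are averaged innermost.\<close>
  have model: "fire_model n p = pmf_of_set {1..n} \<bind> (\<lambda>X. pmf_of_set (parent_maps n) \<bind>
      (\<lambda>f. pmf_of_set (permutations_of_set (edges_of n f)) \<bind>
      (\<lambda>es. map_pmf (\<lambda>s. ((edges_of n f, s), X)) (fire_run p (edges_of n f) es (\<lambda>_. Flammable)))))"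
    unfolding fire_model_def pair_pmf_def fire_dynamics_def rrt
    by (subst bind_commute_pmf)
       (simp add: map_pmf_def bind_assoc_pmf bind_return_pmf)
  have run: "measure_pmf.prob (map_pmf (\<lambda>s. ((edges_of n f, s), X))
      (fire_run p (edges_of n f) es (\<lambda>_. Flammable))) ?A = (1 - p) ^ hits (ancestors f X) es"
    if "X \<in> {1..n}" "f \<in> parent_maps n" "es \<in> permutations_of_set (edges_of n f)" for X f es
  proof -
    have "(\<lambda>s. ((edges_of n f, s), X)) -` ?A = {s. \<forall>v\<in>ancestors f X. fireproof_vertex (edges_of n f) s v}"
      using fireproof_subtree_iff[OF that(2,1)] by auto
    then show ?thesis
      using fire_dynamics_run_prob[OF assms(2,3) that(3)] by simp
  qed
  show ?thesis
    unfolding model prob_bind_pmf using assms(1)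
    by (simp add: expectation_pmf_of_set del: measure_map_pmf One_nat_def) (intro avg_cong run)
qed

section \<open>Growing the tree one vertex at a time\<close>

lemma parent_maps_1: "parent_maps 1 = {\<lambda>_. undefined}"
  by (simp add: parent_maps_def)

text \<open>Vertex \<open>n + 1\<close> picks its parent uniformly in \<open>{1..n}\<close>,
  independently of the tree already grown.\<close>

lemma avg_parent_maps_Suc:
  assumes "n \<ge> 1"
  shows "avg (parent_maps (Suc n)) g = avg (parent_maps n) (\<lambda>f. avg {1..n} (\<lambda>j. g (f(Suc n := j))))"
proof -
  let ?h = "\<lambda>(j, f). f(Suc n := j)"
  have set: "{2..Suc n} = insert (Suc n) {2..n}" using assms by auto
  have "(\<Pi>\<^sub>E v\<in>insert (Suc n) {2..n}. {1..<v}) = ?h ` ({1..<Suc n} \<times> (\<Pi>\<^sub>E v\<in>{2..n}. {1..<v}))"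
    by (rule PiE_insert_eq)
  then have eq: "parent_maps (Suc n) = ?h ` ({1..n} \<times> parent_maps n)"
    by (simp add: parent_maps_def set atLeastLessThanSuc_atLeastAtMost)
  have "inj_on ?h ({1..<Suc n} \<times> (\<Pi>\<^sub>E v\<in>{2..n}. {1..<v}))"
    by (rule inj_combinator) simp
  then have inj: "inj_on ?h ({1..n} \<times> parent_maps n)"
    by (simp add: parent_maps_def atLeastLessThanSuc_atLeastAtMost)
  have "sum g (parent_maps (Suc n)) = (\<Sum>j\<in>{1..n}. \<Sum>f\<in>parent_maps n. g (f(Suc n := j)))"
    unfolding eq sum.reindex[OF inj] by (simp add: sum.cartesian_product case_prod_unfold)
  moreover have "card (parent_maps (Suc n)) = n * card (parent_maps n)"
    unfolding eq card_image[OF inj] by (simp add: card_cartesian_product)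
  ultimately have "avg (parent_maps (Suc n)) g = avg {1..n} (\<lambda>j. avg (parent_maps n) (\<lambda>f. g (f(Suc n := j))))"
    by (simp add: avg_def sum_divide_distrib[symmetric] mult.commute)
  then show ?thesis by (simp add: avg_swap[of "{1..n}"] del: One_nat_def)
qed

text \<open>Let \<open>S\<close> be the sum for the old tree. On average over the parent, pairs with
  the new vertex as target add \<open>S / n\<close>, those with it as source
  \<open>x * S / n\<close>, and the pair of the new vertex with itself adds
  \<open>1\<close>.\<close>

lemma avg_gap_power_Suc:
  assumes "n \<ge> 1"
  shows "avg (parent_maps (Suc n)) (\<lambda>f. \<Sum>v=1..Suc n. \<Sum>w=1..Suc n. x ^ gap f v w) =
    avg (parent_maps n) (\<lambda>f. \<Sum>v=1..n. \<Sum>w=1..n. x ^ gap f v w) * (1 + (1 + x) / real n) + 1"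
proof -
  have "avg {1..n} (\<lambda>j. \<Sum>v=1..Suc n. \<Sum>w=1..Suc n. x ^ gap (f(Suc n := j)) v w) =
      (1 + (1 + x) / real n) * (\<Sum>v=1..n. \<Sum>w=1..n. x ^ gap f v w) + 1"
    if f: "f \<in> parent_maps n" for f
  proof -
    let ?S = "\<Sum>v=1..n. \<Sum>w=1..n. x ^ gap f v w"
    have "(\<Sum>v=1..Suc n. \<Sum>w=1..Suc n. x ^ gap (f(Suc n := j)) v w) =
        ?S + ((\<Sum>v=1..n. x ^ gap f v j) + (x * (\<Sum>w=1..n. x ^ gap f j w) + 1))"
      if "j \<in> {1..n}" for j
      using gap_fun_upd[OF f that] by (simp add: sum.distrib sum_distrib_left)
    then have "avg {1..n} (\<lambda>j. \<Sum>v=1..Suc n. \<Sum>w=1..Suc n. x ^ gap (f(Suc n := j)) v w) =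
        avg {1..n} (\<lambda>j. ?S + ((\<Sum>v=1..n. x ^ gap f v j) + (x * (\<Sum>w=1..n. x ^ gap f j w) + 1)))"
      by (rule avg_cong)
    also have "\<dots> = ?S + (?S / real n + (x * (?S / real n) + 1))"
      using assms unfolding avg_add avg_cmult
      by (simp add: avg_const) (simp add: avg_def sum.swap[of "\<lambda>j v. x ^ gap f v j"])
    also have "S + (S / real n + (x * (S / real n) + 1)) = (1 + (1 + x) / real n) * S + 1" for S
      by (simp add: algebra_simps add_divide_distrib)
    finally show ?thesis .
  qed
  then show ?thesis
    unfolding avg_parent_maps_Suc[OF assms]
    by (simp add: avg_add avg_cmult avg_const cong: avg_cong)
qed

lemma avg_depth_Suc:
  assumes "n \<ge> 1"
  shows "avg (parent_maps (Suc n)) (\<lambda>f. \<Sum>v=1..Suc n. real (gap f v 1)) =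
    avg (parent_maps n) (\<lambda>f. \<Sum>v=1..n. real (gap f v 1)) * (1 + 1 / real n) + 1"
proof -
  have one: "1 \<in> {1..n}" using assms by auto
  have "avg {1..n} (\<lambda>j. \<Sum>v=1..Suc n. real (gap (f(Suc n := j)) v 1)) =
      (1 + 1 / real n) * (\<Sum>v=1..n. real (gap f v 1)) + 1"
    if f: "f \<in> parent_maps n" for f
  proof -
    let ?S = "\<Sum>v=1..n. real (gap f v 1)"
    have "(\<Sum>v=1..Suc n. real (gap (f(Suc n := j)) v 1)) = ?S + (real (gap f j 1) + 1)"
      if "j \<in> {1..n}" for j
      using gap_fun_upd(1)[OF f that _ one] gap_fun_upd(3)[OF f that one one] by simp
    then have "avg {1..n} (\<lambda>j. \<Sum>v=1..Suc n. real (gap (f(Suc n := j)) v 1)) =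
        avg {1..n} (\<lambda>j. ?S + (real (gap f j 1) + 1))"
      by (rule avg_cong)
    also have "\<dots> = ?S + (?S / real n + 1)"
      using assms unfolding avg_add by (simp add: avg_const) (simp add: avg_def)
    finally show ?thesis by (simp add: field_simps)
  qed
  then show ?thesis
    unfolding avg_parent_maps_Suc[OF assms]
    by (simp add: avg_add avg_cmult avg_const cong: avg_cong)
qed

text \<open>By the recursion the mean depth grows by \<open>1 / (n + 1)\<close> from
  \<open>n\<close> to \<open>n + 1\<close>, which is at most
  \<open>ln (n + 1) - ln n\<close>.\<close>

lemma avg_depth_le:
  assumes "n \<ge> 1"
  shows "avg (parent_maps n) (\<lambda>f. \<Sum>v=1..n. real (gap f v 1)) \<le> real n * ln (real n)"
  using assms
proof (induction n rule: dec_induct)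
  case base
  show ?case by (simp add: parent_maps_1[simplified] avg_def)
next
  case (step n)
  have "ln (real n / real (Suc n)) \<le> real n / real (Suc n) - 1"
    using step by (intro ln_le_minus_one) auto
  then have "1 / real (Suc n) \<le> ln (real (Suc n)) - ln (real n)"
    using step by (simp add: ln_div field_simps)
  then have "1 \<le> real (Suc n) * (ln (real (Suc n)) - ln (real n))"
    by (simp add: field_simps)
  moreover have "avg (parent_maps n) (\<lambda>f. \<Sum>v=1..n. real (gap f v 1)) * (1 + 1 / real n) \<le>
      (real n * ln (real n)) * (1 + 1 / real n)"
    using step by (intro mult_right_mono) auto
  moreover have "(real n * ln (real n)) * (1 + 1 / real n) = real (Suc n) * ln (real n)"
    using step by (simp add: field_simps)
  ultimately show ?case
    unfolding avg_depth_Suc[OF step(1)] by (simp only: right_diff_distrib)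
qed

text \<open>Weighted AM-GM for \<open>1 + a * t\<close> and \<open>1\<close> with weights
  \<open>1 / a\<close> and \<open>1 - 1 / a\<close>.\<close>

lemma Bernoulli_powr:
  fixes a t :: real
  assumes "1 \<le> a" "0 \<le> t"
  shows "1 + a * t \<le> (1 + t) powr a"
proof -
  have pos: "0 < 1 + a * t" using assms by (simp add: add_pos_nonneg)
  have "(1 + a * t) powr (1 / a) * 1 powr (1 - 1 / a) \<le> (1 / a) * (1 + a * t) + (1 - 1 / a) * 1"
    using assms pos by (intro Youngs_inequality_0) auto
  also have "\<dots> = 1 + t" using assms by (simp add: field_simps)
  finally have "((1 + a * t) powr (1 / a)) powr a \<le> (1 + t) powr a"
    using assms by (intro powr_mono2) auto
  then show ?thesis using assms pos by (simp add: powr_powr)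
qed

lemma avg_gap_power_le:
  assumes "n \<ge> 1" "0 < x" "x \<le> 1"
  shows "avg (parent_maps n) (\<lambda>f. \<Sum>v=1..n. \<Sum>w=1..n. x ^ gap f v w) \<le> (1 + 1 / x) * real n powr (1 + x)"
proof -
  let ?Q = "\<lambda>n. avg (parent_maps n) (\<lambda>f. \<Sum>v=1..n. \<Sum>w=1..n. x ^ gap f v w)"
  \<comment> \<open>Adding \<open>n / x\<close> makes the recursion homogeneous: the sum is
    multiplied by exactly \<open>1 + (1 + x) / n\<close> in each step.\<close>
  have "?Q n + real n / x \<le> (1 + 1 / x) * real n powr (1 + x)"
    using assms(1)
  proof (induction n rule: dec_induct)
    case base
    show ?case by (simp add: parent_maps_1[simplified] avg_def)
  next
    case (step n)
    have "?Q (Suc n) + real (Suc n) / x = (?Q n + real n / x) * (1 + (1 + x) / real n)"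
      unfolding avg_gap_power_Suc[OF step(1)] using step assms(2) by (simp add: field_simps)
    also have "\<dots> \<le> ((1 + 1 / x) * real n powr (1 + x)) * (1 + 1 / real n) powr (1 + x)"
    proof (intro mult_mono step.IH)
      show "1 + (1 + x) / real n \<le> (1 + 1 / real n) powr (1 + x)"
        using Bernoulli_powr[of "1 + x" "1 / real n"] assms by simp
    qed (use assms in auto)
    also have "\<dots> = (1 + 1 / x) * (real n * (1 + 1 / real n)) powr (1 + x)"
      by (simp add: powr_mult)
    also have "real n * (1 + 1 / real n) = real (Suc n)"
      using step by (simp add: field_simps)
    finally show ?case .
  qed
  moreover have "0 \<le> real n / x" using assms by simp
  ultimately show ?thesis by linarith
qed

section \<open>Moments of the number of hits\<close>

lemma avg_of_bool: "finite A \<Longrightarrow> avg A (\<lambda>a. of_bool (P a)) = real (card {a \<in> A. P a}) / real (card A)"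
  by (simp add: avg_def of_bool_def sum.If_cases Int_def)

text \<open>The edge above \<open>v\<close> comes first on its branch with probability one over the
  number of edges of the branch.\<close>

lemma avg_hits:
  assumes "f \<in> parent_maps n" "w \<in> {1..n}"
  shows "avg (permutations_of_set (edges_of n f)) (\<lambda>es. real (hits (ancestors f w) es)) =
    (\<Sum>v\<in>{2..n}. 1 / real (max 1 (gap f v w)))"
proof -
  let ?P = "permutations_of_set (edges_of n f)"
  let ?F = "\<lambda>v. edge_above f ` branch f v w"
  have "avg ?P (\<lambda>es. real (hits (ancestors f w) es)) =
      avg ?P (\<lambda>es. \<Sum>v\<in>{2..n}. of_bool (first_in (?F v) es = edge_above f v))"
    by (rule avg_cong) (simp add: hits_eq_first[OF assms])
  also have "\<dots> = (\<Sum>v\<in>{2..n}. 1 / real (max 1 (gap f v w)))"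
    unfolding avg_sum
  proof (rule sum.cong[OF refl])
    fix v assume v: "v \<in> {2..n}"
    have sub: "branch f v w \<subseteq> {2..n}" by (rule branch_subset[OF assms(1) v assms(2)])
    have cardF: "card (?F v) = max 1 (gap f v w)"
      by (simp add: card_image inj_on_subset[OF inj_on_edge_above[OF assms(1)] sub] card_branch)
    have "card (?F v) * card {es \<in> ?P. first_in (?F v) es = edge_above f v} = card ?P"
      using sub by (intro card_first_in) (auto simp: edges_of_eq branch_def)
    then have "real (max 1 (gap f v w)) * real (card {es \<in> ?P. first_in (?F v) es = edge_above f v}) =
        real (card ?P)" unfolding cardF by (metis of_nat_mult)
    moreover have "card ?P > 0" by (simp add: card_gt_0_iff)
    ultimately show "avg ?P (\<lambda>es. of_bool (first_in (?F v) es = edge_above f v)) = 1 / real (max 1 (gap f v w))"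
      unfolding avg_of_bool[OF finite_permutations_of_set] by (simp add: field_simps)
  qed
  finally show ?thesis .
qed

text \<open>The parts of the two paths to the root below their meeting point are disjoint, so that being
  first on both of them are independent events.\<close>

lemma avg_both_first_le:
  assumes f: "f \<in> parent_maps n" and u: "u \<in> {2..n}" and v: "v \<in> {2..n}" and M: "M > 0"
  shows "avg (permutations_of_set (edges_of n f))
      (\<lambda>es. of_bool (first_in (edge_above f ` branch f u 1) es = edge_above f u) *
            of_bool (first_in (edge_above f ` branch f v 1) es = edge_above f v))
    \<le> 1 / M\<^sup>2 + of_bool (real (gap f u v) < M) + of_bool (real (gap f v u) < M)"
    (is "avg ?P ?g \<le> _")
proof (cases "real (gap f u v) < M \<or> real (gap f v u) < M")
  \<comment> \<open>Here the trivial bound \<open>1\<close> suffices. This covers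
    \<open>u = v\<close>, whose gap is \<open>0\<close>.\<close>
  case True
  have "avg ?P ?g \<le> avg ?P (\<lambda>_. 1)" by (intro avg_mono) auto
  also have "\<dots> = 1" by (intro avg_const) auto
  also have "1 \<le> 1 / M\<^sup>2 + of_bool (real (gap f u v) < M) + of_bool (real (gap f v u) < M)"
    using True by (auto simp: of_bool_def)
  finally show ?thesis .
next
  case False
  have one: "1 \<in> {1..n}" and uv1: "u \<in> {1..n}" "v \<in> {1..n}" using u v by auto
  have gap_pos: "gap f u v > 0" "gap f v u > 0" using False M by (auto intro!: Nat.gr0I)
  then have nanc: "u \<notin> ancestors f v" "v \<notin> ancestors f u"
    using ancestors_mono[of u f v] ancestors_mono[of v f u]
    by (auto simp: gap_def Diff_eq_empty_iff[THEN iffD2])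
  then have br: "branch f u v = ancestors f u - ancestors f v" "branch f v u = ancestors f v - ancestors f u"
    by (auto simp: branch_def)
  let ?F = "edge_above f ` branch f u v" and ?G = "edge_above f ` branch f v u"
  note inj = inj_on_edge_above[OF f]
  have sub: "branch f u v \<subseteq> {2..n}" "branch f v u \<subseteq> {2..n}"
    using branch_subset[OF f u uv1(2)] branch_subset[OF f v uv1(1)] by auto
  have cards: "card ?F = gap f u v" "card ?G = gap f v u"
    using gap_pos card_branch[of f u v] card_branch[of f v u]
    by (simp_all add: card_image[OF inj_on_subset[OF inj sub(1)]] card_image[OF inj_on_subset[OF inj sub(2)]])
  \<comment> \<open>Coming first on the whole way to the root implies coming first on the part below
    the meeting point.\<close>
  have first: "first_in (edge_above f ` branch f a b) es = edge_above f a"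
    if "es \<in> ?P" "first_in (edge_above f ` branch f a 1) es = edge_above f a"
      "a \<in> {2..n}" "b \<in> {1..n}" for es a b
  proof (rule first_in_mono[THEN trans, OF _ _ _ _ that(2)])
    have "1 \<in> ancestors f b" using ancestors_props[OF f that(4)] by blast
    then show "edge_above f ` branch f a b \<subseteq> edge_above f ` branch f a 1"
      by (intro image_mono) (auto simp: branch_def)
    show "edge_above f ` branch f a 1 \<subseteq> set es"
      using branch_subset[OF f that(3) one] permutations_of_setD(1)[OF that(1)] by (auto simp: edges_of_eq)
    show "distinct es" using permutations_of_setD(2)[OF that(1)] .
    show "first_in (edge_above f ` branch f a 1) es \<in> edge_above f ` branch f a b"
      unfolding that(2) by (simp add: branch_def)
  qed
  let ?Q = "\<lambda>es. first_in ?F es = edge_above f u \<and> first_in ?G es = edge_above f v"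
  have "card ?F * card ?G * card {es \<in> ?P. ?Q es} = card ?P"
  proof (rule card_first_in_both)
    show "?F \<inter> ?G = {}"
      using sub br by (subst inj_on_image_Int[OF inj, symmetric]) auto
  qed (use sub in \<open>auto simp: edges_of_eq branch_def\<close>)
  then have "real (gap f u v) * real (gap f v u) * real (card {es \<in> ?P. ?Q es}) = real (card ?P)"
    unfolding cards of_nat_mult[symmetric] by (rule arg_cong)
  moreover have "card ?P > 0" by (simp add: card_gt_0_iff)
  ultimately have "avg ?P (\<lambda>es. of_bool (?Q es)) = 1 / (real (gap f u v) * real (gap f v u))"
    unfolding avg_of_bool[OF finite_permutations_of_set] using gap_pos by (simp add: field_simps)
  also have "\<dots> \<le> 1 / M\<^sup>2"
    unfolding power2_eq_square using False M by (intro divide_left_mono mult_mono mult_pos_pos) auto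
  finally have "avg ?P (\<lambda>es. of_bool (?Q es)) \<le> 1 / M\<^sup>2" .
  moreover have "avg ?P ?g \<le> avg ?P (\<lambda>es. of_bool (?Q es))"
    using first[OF _ _ u uv1(2)] first[OF _ _ v uv1(1)] by (intro avg_mono) (auto simp: of_bool_def)
  ultimately show ?thesis using False by simp
qed

lemma avg_hits_square_le:
  assumes f: "f \<in> parent_maps n" and n: "n \<ge> 1" and M: "M > 0"
  shows "avg (permutations_of_set (edges_of n f)) (\<lambda>es. (real (hits (ancestors f 1) es))\<^sup>2) \<le>
    (\<Sum>u=1..n. \<Sum>v=1..n. 1 / M\<^sup>2 + of_bool (real (gap f u v) < M) + of_bool (real (gap f v u) < M))"
proof -
  let ?P = "permutations_of_set (edges_of n f)"
  let ?B = "\<lambda>u es. of_bool (first_in (edge_above f ` branch f u 1) es = edge_above f u) :: real"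
  let ?S = "\<lambda>u v. 1 / M\<^sup>2 + of_bool (real (gap f u v) < M) + of_bool (real (gap f v u) < M)"
  have one: "1 \<in> {1..n}" using n by auto
  have "avg ?P (\<lambda>es. (real (hits (ancestors f 1) es))\<^sup>2) =
      avg ?P (\<lambda>es. \<Sum>u\<in>{2..n}. \<Sum>v\<in>{2..n}. ?B u es * ?B v es)"
  proof (rule avg_cong)
    fix es assume "es \<in> ?P"
    then have "real (hits (ancestors f 1) es) = (\<Sum>u\<in>{2..n}. ?B u es)"
      by (simp only: hits_eq_first[OF f one] of_nat_sum of_nat_of_bool)
    then show "(real (hits (ancestors f 1) es))\<^sup>2 = (\<Sum>u\<in>{2..n}. \<Sum>v\<in>{2..n}. ?B u es * ?B v es)"
      by (simp only: power2_eq_square sum_product)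
  qed
  also have "\<dots> = (\<Sum>u\<in>{2..n}. \<Sum>v\<in>{2..n}. avg ?P (\<lambda>es. ?B u es * ?B v es))"
    by (simp only: avg_sum)
  also have "\<dots> \<le> (\<Sum>u\<in>{2..n}. \<Sum>v\<in>{2..n}. ?S u v)"
    by (intro sum_mono avg_both_first_le f M)
  \<comment> \<open>The terms are nonnegative, so the root may be added to both ranges to match the
    sums in \<open>tail_sum_le\<close>.\<close>
  also have "\<dots> \<le> (\<Sum>u=1..n. \<Sum>v\<in>{2..n}. ?S u v)"
    by (intro sum_mono2 sum_nonneg) auto
  also have "\<dots> \<le> (\<Sum>u=1..n. \<Sum>v=1..n. ?S u v)"
    by (intro sum_mono sum_mono2) auto
  finally show ?thesis .
qed

text \<open>Chernoff's method: \<open>x powr (g - M)\<close> is at least \<open>1\<close> on the event \<open>g < M\<close>.\<close>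

lemma of_bool_less_le:
  assumes "0 < x" "x \<le> 1"
  shows "of_bool (real g < M) \<le> x powr (- M) * x ^ g"
proof (cases "real g < M")
  case True
  have "1 = x powr 0" using assms by simp
  also have "\<dots> \<le> x powr (real g - M)" using True assms by (intro powr_mono') auto
  also have "\<dots> = x powr (- M) * x ^ g"
    using assms by (simp add: powr_realpow[symmetric] powr_add[symmetric])
  finally show ?thesis using True by simp
qed (use assms in simp)

lemma tail_sum_le:
  assumes "n \<ge> 1" "0 < x" "x \<le> 1"
  shows "avg (parent_maps n) (\<lambda>f. \<Sum>v=1..n. \<Sum>w=1..n. of_bool (real (gap f v w) < M)) \<le>
    x powr (- M) * ((1 + 1 / x) * real n powr (1 + x))"
proof -
  have "avg (parent_maps n) (\<lambda>f. \<Sum>v=1..n. \<Sum>w=1..n. of_bool (real (gap f v w) < M)) \<le>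
      avg (parent_maps n) (\<lambda>f. \<Sum>v=1..n. \<Sum>w=1..n. x powr (- M) * x ^ gap f v w)"
    using assms by (intro avg_mono sum_mono of_bool_less_le)
  also have "\<dots> = x powr (- M) * avg (parent_maps n) (\<lambda>f. \<Sum>v=1..n. \<Sum>w=1..n. x ^ gap f v w)"
    by (simp only: sum_distrib_left[symmetric] avg_cmult)
  also have "\<dots> \<le> x powr (- M) * ((1 + 1 / x) * real n powr (1 + x))"
    using avg_gap_power_le[OF assms] by (intro mult_left_mono) auto
  finally show ?thesis .
qed

section \<open>Moments averaged over tree and order\<close>

definition tree_avg :: "nat \<Rightarrow> ((nat \<Rightarrow> nat) \<Rightarrow> nat set list \<Rightarrow> real) \<Rightarrow> real" where
  "tree_avg n g = avg (parent_maps n) (\<lambda>f. avg (permutations_of_set (edges_of n f)) (g f))"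

lemma tree_avg_mono:
  assumes "\<And>f es. f \<in> parent_maps n \<Longrightarrow> es \<in> permutations_of_set (edges_of n f) \<Longrightarrow> g f es \<le> h f es"
  shows "tree_avg n g \<le> tree_avg n h"
  unfolding tree_avg_def using assms by (intro avg_mono) auto

lemma tree_avg_add: "tree_avg n (\<lambda>f es. g f es + h f es) = tree_avg n g + tree_avg n h"
  by (simp add: tree_avg_def avg_add)

lemma tree_avg_diff: "tree_avg n (\<lambda>f es. g f es - h f es) = tree_avg n g - tree_avg n h"
  by (simp add: tree_avg_def avg_diff)

lemma tree_avg_cmult: "tree_avg n (\<lambda>f es. c * g f es) = c * tree_avg n g"
  by (simp add: tree_avg_def avg_cmult)

lemma tree_avg_const: "tree_avg n (\<lambda>f es. c) = c"
  by (simp add: tree_avg_def avg_const)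

text \<open>A pair with gap at least \<open>M\<close> contributes at most \<open>1 / M\<close>. The
  other pairs contribute at most \<open>1\<close> each, and \<open>tail_sum_le\<close> bounds their
  number.\<close>

lemma mean_hits_le:
  assumes "n \<ge> 1" "0 < x" "x \<le> 1" "M > 0"
  shows "avg {1..n} (\<lambda>X. tree_avg n (\<lambda>f es. real (hits (ancestors f X) es))) \<le>
    real n / M + x powr (- M) * ((1 + 1 / x) * real n powr (1 + x)) / real n"
proof -
  have pt: "1 / real (max 1 g) \<le> 1 / M + of_bool (real g < M)" for g :: nat
  proof (cases "real g < M")
    case True
    have "1 / real (max 1 g) \<le> 1" by simp
    also have "\<dots> \<le> 1 / M + of_bool (real g < M)" using True assms(4) by simp
    finally show ?thesis .
  next
    case False
    then show ?thesis using assms(4) by (auto intro!: divide_left_mono)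
  qed
  have "tree_avg n (\<lambda>f es. real (hits (ancestors f X) es)) \<le>
      avg (parent_maps n) (\<lambda>f. \<Sum>v=1..n. 1 / M + of_bool (real (gap f v X) < M))"
    if X: "X \<in> {1..n}" for X
    unfolding tree_avg_def
  proof (rule avg_mono)
    fix f assume f: "f \<in> parent_maps n"
    have "avg (permutations_of_set (edges_of n f)) (\<lambda>es. real (hits (ancestors f X) es)) =
        (\<Sum>v\<in>{2..n}. 1 / real (max 1 (gap f v X)))" by (rule avg_hits[OF f X])
    also have "\<dots> \<le> (\<Sum>v\<in>{2..n}. 1 / M + of_bool (real (gap f v X) < M))" by (intro sum_mono pt)
    also have "\<dots> \<le> (\<Sum>v=1..n. 1 / M + of_bool (real (gap f v X) < M))"
      using assms(4) by (intro sum_mono2) auto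
    finally show "avg (permutations_of_set (edges_of n f)) (\<lambda>es. real (hits (ancestors f X) es)) \<le>
        (\<Sum>v=1..n. 1 / M + of_bool (real (gap f v X) < M))" .
  qed
  then have "avg {1..n} (\<lambda>X. tree_avg n (\<lambda>f es. real (hits (ancestors f X) es))) \<le>
      avg {1..n} (\<lambda>X. avg (parent_maps n) (\<lambda>f. \<Sum>v=1..n. 1 / M + of_bool (real (gap f v X) < M)))"
    by (rule avg_mono)
  also have "\<dots> = avg (parent_maps n) (\<lambda>f. avg {1..n} (\<lambda>X. \<Sum>v=1..n. 1 / M + of_bool (real (gap f v X) < M)))"
    by (rule avg_swap)
  also have "\<dots> = avg (parent_maps n) (\<lambda>f. real n / M + 1 / real n *
      (\<Sum>v=1..n. \<Sum>X=1..n. of_bool (real (gap f v X) < M)))"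
  proof (rule avg_cong)
    fix f
    have "avg {1..n} (\<lambda>X. \<Sum>v=1..n. 1 / M + of_bool (real (gap f v X) < M)) =
        avg {1..n} (\<lambda>X. real n / M) + avg {1..n} (\<lambda>X. \<Sum>v=1..n. of_bool (real (gap f v X) < M))"
      unfolding avg_add[symmetric] by (simp add: sum.distrib)
    also have "avg {1..n} (\<lambda>X. real n / M) = real n / M" using assms(1) by (intro avg_const) auto
    also have "avg {1..n} (\<lambda>X. \<Sum>v=1..n. of_bool (real (gap f v X) < M)) =
        1 / real n * (\<Sum>v=1..n. \<Sum>X=1..n. of_bool (real (gap f v X) < M))"
      unfolding avg_def by (subst sum.swap) simp
    finally show "avg {1..n} (\<lambda>X. \<Sum>v=1..n. 1 / M + of_bool (real (gap f v X) < M)) =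
        real n / M + 1 / real n * (\<Sum>v=1..n. \<Sum>X=1..n. of_bool (real (gap f v X) < M))" .
  qed
  also have "\<dots> = real n / M + 1 / real n *
      avg (parent_maps n) (\<lambda>f. \<Sum>v=1..n. \<Sum>X=1..n. of_bool (real (gap f v X) < M))"
    by (simp only: avg_add avg_cmult avg_const[OF finite_parent_maps parent_maps_nonempty])
  also have "\<dots> \<le> real n / M + 1 / real n * (x powr (- M) * ((1 + 1 / x) * real n powr (1 + x)))"
    using tail_sum_le[OF assms(1-3)] by (intro add_left_mono mult_left_mono) auto
  finally show ?thesis by simp
qed

text \<open>\<open>avg_hits_square_le\<close> leaves two tail sums, which agree after swapping
  \<open>u\<close> and \<open>v\<close>.\<close>

lemma mean_square_hits_le:
  assumes "n \<ge> 1" "0 < x" "x \<le> 1" "M > 0"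
  shows "tree_avg n (\<lambda>f es. (real (hits (ancestors f 1) es))\<^sup>2) \<le>
    (real n)\<^sup>2 / M\<^sup>2 + 2 * (x powr (- M) * ((1 + 1 / x) * real n powr (1 + x)))"
proof -
  let ?T = "\<lambda>f. \<Sum>u=1..n. \<Sum>v=1..n. of_bool (real (gap f u v) < M) :: real"
  have "tree_avg n (\<lambda>f es. (real (hits (ancestors f 1) es))\<^sup>2) \<le>
      avg (parent_maps n) (\<lambda>f. \<Sum>u=1..n. \<Sum>v=1..n. 1 / M\<^sup>2 + of_bool (real (gap f u v) < M) + of_bool (real (gap f v u) < M))"
    unfolding tree_avg_def using assms by (intro avg_mono avg_hits_square_le) auto
  also have "\<dots> = avg (parent_maps n) (\<lambda>f. (real n)\<^sup>2 / M\<^sup>2 + 2 * ?T f)"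
  proof (rule avg_cong)
    fix f
    have "(\<Sum>u=1..n. \<Sum>v=1..n. of_bool (real (gap f v u) < M)) = ?T f" by (rule sum.swap)
    then show "(\<Sum>u=1..n. \<Sum>v=1..n. 1 / M\<^sup>2 + of_bool (real (gap f u v) < M) + of_bool (real (gap f v u) < M)) =
        (real n)\<^sup>2 / M\<^sup>2 + 2 * ?T f"
      unfolding sum.distrib by (simp add: power2_eq_square)
  qed
  also have "\<dots> = (real n)\<^sup>2 / M\<^sup>2 + 2 * avg (parent_maps n) ?T"
    by (simp only: avg_add avg_cmult avg_const[OF finite_parent_maps parent_maps_nonempty])
  also have "\<dots> \<le> (real n)\<^sup>2 / M\<^sup>2 + 2 * (x powr (- M) * ((1 + 1 / x) * real n powr (1 + x)))"
    using tail_sum_le[OF assms(1-3)] by (intro add_left_mono mult_left_mono) auto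
  finally show ?thesis .
qed

text \<open>The convex function \<open>1 / d\<close> is replaced by its tangent at
  \<open>d = ln n\<close>. Being linear in the depth, it only requires the bound
  \<open>n * ln n\<close> on the total depth.\<close>

lemma mean_hits_ge:
  assumes "n \<ge> 2"
  shows "(real n - 2) / ln (real n) \<le> tree_avg n (\<lambda>f es. real (hits (ancestors f 1) es))"
proof -
  define L where "L = ln (real n)"
  have L: "L > 0" using assms by (simp add: L_def)
  have one: "1 \<in> {1..n}" using assms by auto
  have pt: "2 / L - d / L\<^sup>2 \<le> 1 / d" if "d > 0" for d
  proof -
    have "0 \<le> (d - L)\<^sup>2 / (d * L\<^sup>2)" using that by simp
    also have "\<dots> = 1 / d - (2 / L - d / L\<^sup>2)"
      using that L by (simp add: field_simps power2_eq_square)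
    finally show ?thesis by simp
  qed
  let ?D = "\<lambda>f. \<Sum>v=1..n. real (gap f v 1)"
  have "2 * (real n - 1) / L - real n * L / L\<^sup>2 \<le> 2 * (real n - 1) / L - avg (parent_maps n) ?D / L\<^sup>2"
    using avg_depth_le[of n] assms by (intro diff_left_mono divide_right_mono) (auto simp: L_def)
  also have "\<dots> = avg (parent_maps n) (\<lambda>f. 2 * (real n - 1) / L - 1 / L\<^sup>2 * ?D f)"
    by (simp only: avg_diff avg_cmult avg_const[OF finite_parent_maps parent_maps_nonempty]) simp
  also have "\<dots> \<le> tree_avg n (\<lambda>f es. real (hits (ancestors f 1) es))"
    unfolding tree_avg_def
  proof (rule avg_mono)
    fix f assume f: "f \<in> parent_maps n"
    have pos: "gap f v 1 > 0" if "v \<in> {2..n}" for v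
    proof -
      have "v \<in> ancestors f v - ancestors f 1" using that by auto
      then show ?thesis unfolding gap_def
        by (metis card_gt_0_iff empty_iff finite_Diff finite_ancestors)
    qed
    have "?D f = (\<Sum>v\<in>{2..n}. real (gap f v 1))"
    proof (rule sum.mono_neutral_right)
      have "{1..n} - {2..n} \<subseteq> {1}" by auto
      then show "\<forall>v\<in>{1..n} - {2..n}. real (gap f v 1) = 0" by auto
    qed auto
    then have "2 * (real n - 1) / L - 1 / L\<^sup>2 * ?D f = (\<Sum>v\<in>{2..n}. 2 / L - real (gap f v 1) / L\<^sup>2)"
      using assms by (simp add: sum_subtractf sum_divide_distrib of_nat_diff)
    also have "\<dots> \<le> (\<Sum>v\<in>{2..n}. 1 / real (max 1 (gap f v 1)))"
    proof (rule sum_mono)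
      fix v assume v: "v \<in> {2..n}"
      have "max 1 (gap f v 1) = gap f v 1" using pos[OF v] by simp
      then show "2 / L - real (gap f v 1) / L\<^sup>2 \<le> 1 / real (max 1 (gap f v 1))"
        using pt[of "real (gap f v 1)"] pos[OF v] by simp
    qed
    also have "\<dots> = avg (permutations_of_set (edges_of n f)) (\<lambda>es. real (hits (ancestors f 1) es))"
      by (rule avg_hits[OF f one, symmetric])
    finally show "2 * (real n - 1) / L - 1 / L\<^sup>2 * ?D f \<le>
        avg (permutations_of_set (edges_of n f)) (\<lambda>es. real (hits (ancestors f 1) es))" .
  qed
  finally have "2 * (real n - 1) / L - real n * L / L\<^sup>2 \<le> tree_avg n (\<lambda>f es. real (hits (ancestors f 1) es))" .
  moreover have "2 * (real n - 1) / L - real n * L / L\<^sup>2 = (real n - 2) / L"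
    using L by (simp add: field_simps power2_eq_square)
  ultimately show ?thesis by (simp add: L_def)
qed

section \<open>Asymptotics\<close>

text \<open>The tangent at \<open>c\<close> lies below the convex function.\<close>

lemma exp_minus_ge_tangent: "exp (- c) * (1 + c - t) \<le> exp (- t)" for c t :: real
proof -
  have "exp (- c) * (1 + (c - t)) \<le> exp (- c) * exp (c - t)"
    using exp_ge_add_one_self[of "c - t"] by (intro mult_left_mono) auto
  then show ?thesis by (simp add: exp_add[symmetric] algebra_simps)
qed

text \<open>Tangent plus a quadratic error, so that two moments suffice. For \<open>t < c\<close>
  the deviation \<open>c - t\<close> is at most \<open>c\<close>, and the resulting factor
  \<open>exp c\<close> cancels against \<open>exp (- c)\<close>.\<close>

lemma exp_minus_le_quadratic:
  fixes c t :: real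
  assumes "0 \<le> c" "0 \<le> t"
  shows "exp (- t) \<le> exp (- c) * (1 + c - t) + (t - c)\<^sup>2"
proof -
  define s where "s = t - c"
  have "exp (- s) \<le> 1 - s + exp c * s\<^sup>2"
  proof (cases "s \<ge> 0")
    case True
    have "1 + s \<le> exp s" by (rule exp_ge_add_one_self)
    then have "exp (- s) \<le> 1 / (1 + s)" using True by (simp add: exp_minus field_simps)
    also have "\<dots> \<le> 1 - s + s\<^sup>2"
      using True by (simp add: field_simps power2_eq_square)
    also have "\<dots> \<le> 1 - s + exp c * s\<^sup>2"
      using assms(1) mult_right_mono[of 1 "exp c" "s\<^sup>2"] by simp
    finally show ?thesis .
  next
    case False
    define r where "r = - s"
    have r: "0 \<le> r" "r \<le> c" using False assms by (auto simp: r_def s_def)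
    have step: "exp r - 1 \<le> r * exp r"
    proof -
      have "exp r * (1 - r) \<le> exp r * exp (- r)"
        using exp_ge_add_one_self[of "- r"] by (intro mult_left_mono) auto
      then show ?thesis by (simp add: exp_minus algebra_simps)
    qed
    then have "r * (exp r - 1) \<le> r * (r * exp r)" using r by (intro mult_left_mono) auto
    also have "\<dots> \<le> exp c * r\<^sup>2"
      using r mult_right_mono[of "exp r" "exp c" "r\<^sup>2"] by (simp add: power2_eq_square mult_ac)
    finally have "exp r \<le> 1 + r + exp c * r\<^sup>2" using step by (simp add: algebra_simps)
    then show ?thesis by (simp add: r_def)
  qed
  then have "exp (- c) * exp (- s) \<le> exp (- c) * (1 - s + exp c * s\<^sup>2)"
    by (intro mult_left_mono) auto
  then show ?thesis
    by (simp add: s_def exp_add[symmetric] distrib_left mult.assoc[symmetric] algebra_simps)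
qed

text \<open>With \<open>exp (- a)\<close> in the role of \<open>1 - p\<close>, the tangent bound is
  linear in the number of hits, so only its mean enters.\<close>

lemma fire_prob_ge:
  assumes "n \<ge> 1" "0 \<le> a"
  shows "exp (- c) * (1 + c - a * avg {1..n} (\<lambda>X. tree_avg n (\<lambda>f es. real (hits (ancestors f X) es))))
    \<le> avg {1..n} (\<lambda>X. tree_avg n (\<lambda>f es. exp (- a) ^ hits (ancestors f X) es))"
proof -
  have "exp (- c) * (1 + c - a * avg {1..n} (\<lambda>X. tree_avg n (\<lambda>f es. real (hits (ancestors f X) es)))) =
    avg {1..n} (\<lambda>X. tree_avg n (\<lambda>f es. exp (- c) * (1 + c - a * real (hits (ancestors f X) es))))"
    using assms(1) by (simp add: avg_cmult avg_diff avg_const tree_avg_cmult tree_avg_diff tree_avg_const)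
  also have "\<dots> \<le> avg {1..n} (\<lambda>X. tree_avg n (\<lambda>f es. exp (- a) ^ hits (ancestors f X) es))"
    by (intro avg_mono tree_avg_mono, subst exp_of_nat_mult[symmetric])
       (metis exp_minus_ge_tangent mult.commute mult_minus_left)
  finally show ?thesis .
qed

text \<open>If a vertex \<open>X\<close> is in the fireproof subtree of the root, then the root is fireproof, and the number
  of edges that have to resist for that does not depend on \<open>X\<close>.\<close>

lemma fire_prob_le:
  assumes "n \<ge> 1" "0 \<le> a" "0 \<le> c"
  shows "avg {1..n} (\<lambda>X. tree_avg n (\<lambda>f es. exp (- a) ^ hits (ancestors f X) es)) \<le>
    exp (- c) * (1 + c - a * tree_avg n (\<lambda>f es. real (hits (ancestors f 1) es))) +
    (a\<^sup>2 * tree_avg n (\<lambda>f es. (real (hits (ancestors f 1) es))\<^sup>2)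
      - 2 * a * c * tree_avg n (\<lambda>f es. real (hits (ancestors f 1) es)) + c\<^sup>2)"
proof -
  let ?h = "\<lambda>f es. real (hits (ancestors f 1) es)"
  have "avg {1..n} (\<lambda>X. tree_avg n (\<lambda>f es. exp (- a) ^ hits (ancestors f X) es)) \<le>
      avg {1..n} (\<lambda>X. tree_avg n (\<lambda>f es. exp (- c) * (1 + c - a * ?h f es) +
        (a\<^sup>2 * (?h f es)\<^sup>2 - 2 * a * c * ?h f es + c\<^sup>2)))"
  proof (intro avg_mono tree_avg_mono)
    fix X f es assume X: "X \<in> {1..n}" and f: "f \<in> parent_maps n"
    have "{1} \<subseteq> ancestors f X" using ancestors_props[OF f X] by auto
    then have "hits (ancestors f 1) es \<le> hits (ancestors f X) es"
      using hits_mono by simp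
    then have "exp (- a) ^ hits (ancestors f X) es \<le> exp (- a) ^ hits (ancestors f 1) es"
      using assms(2) by (intro power_decreasing) auto
    also have "\<dots> = exp (- (a * ?h f es))"
      by (simp add: exp_of_nat_mult[symmetric] mult.commute)
    also have "\<dots> \<le> exp (- c) * (1 + c - a * ?h f es) + (a * ?h f es - c)\<^sup>2"
      using assms by (intro exp_minus_le_quadratic) auto
    also have "(a * ?h f es - c)\<^sup>2 = a\<^sup>2 * (?h f es)\<^sup>2 - 2 * a * c * ?h f es + c\<^sup>2"
      by (simp add: power2_diff power_mult_distrib mult_ac)
    finally show "exp (- a) ^ hits (ancestors f X) es \<le> exp (- c) * (1 + c - a * ?h f es) +
        (a\<^sup>2 * (?h f es)\<^sup>2 - 2 * a * c * ?h f es + c\<^sup>2)" .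
  qed
  also have "\<dots> = tree_avg n (\<lambda>f es. exp (- c) * (1 + c - a * ?h f es) +
        (a\<^sup>2 * (?h f es)\<^sup>2 - 2 * a * c * ?h f es + c\<^sup>2))"
    using assms(1) by (intro avg_const) auto
  finally show ?thesis
    by (simp only: tree_avg_add tree_avg_diff tree_avg_cmult tree_avg_const)
qed

section \<open>Limits of the rate and of the error terms\<close>

lemma minus_ln_le:
  fixes p :: real
  assumes "0 \<le> p" "p < 1"
  shows "p \<le> - ln (1 - p)" "- ln (1 - p) \<le> p / (1 - p)"
proof -
  show "p \<le> - ln (1 - p)" using ln_le_minus_one[of "1 - p"] assms by simp
  have "- ln (1 - p) = ln (1 / (1 - p))" using assms by (simp add: ln_div)
  also have "\<dots> \<le> 1 / (1 - p) - 1" using assms by (intro ln_le_minus_one) auto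
  also have "\<dots> = p / (1 - p)" using assms by (simp add: field_simps)
  finally show "- ln (1 - p) \<le> p / (1 - p)" .
qed

text \<open>The bound of \<open>tail_sum_le\<close> at level \<open>M = x * ln n\<close>, scaled by
  the square of \<open>ln n / n\<close>.\<close>

definition chernoff_error :: "real \<Rightarrow> nat \<Rightarrow> real" where
  "chernoff_error x n = (1 + 1 / x) * ((ln (real n))\<^sup>2 * real n powr (x - 1 - x * ln x))"

lemma chernoff_error_tendsto:
  assumes "0 < x" "x < 1"
  shows "chernoff_error x \<longlonglongrightarrow> 0"
proof -
  define d where "d = 1 - x + x * ln x"
  \<comment> \<open>The strict inequality \<open>ln x > 1 - 1 / x\<close> makes the exponent of
    \<open>n\<close> negative.\<close>
  have "x * (1 - 1 / x) < x * ln x"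
  proof (rule mult_strict_left_mono)
    have "ln (1 / x) < 1 / x - 1"
      using ln_add_one_self_less_self[of "1 / x - 1"] assms by simp
    then show "1 - 1 / x < ln x" using assms by (simp add: ln_div)
  qed fact
  then have "d > 0" using assms by (simp add: d_def right_diff_distrib)
  then have "(\<lambda>n. (ln (real n))\<^sup>2 * real n powr (- d)) \<longlonglongrightarrow> 0" by real_asymp
  moreover have "x - 1 - x * ln x = - d" by (simp add: d_def)
  ultimately show ?thesis
    unfolding chernoff_error_def by (intro tendsto_mult_right_zero) simp
qed

lemma chernoff_error_bound:
  assumes "n \<ge> 3" "0 < x" "x < 1"
  shows "ln (real n) / real n * (x powr (- (x * ln (real n))) * ((1 + 1 / x) * real n powr (1 + x)) / real n) \<le> chernoff_error x n"
    and "(ln (real n))\<^sup>2 / (real n)\<^sup>2 * (x powr (- (x * ln (real n))) * ((1 + 1 / x) * real n powr (1 + x))) = chernoff_error x n"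
proof -
  have n: "real n > 0" using assms by simp
  have sq: "(real n)\<^sup>2 = real n powr 2" using n by simp
  have "real n powr (- (x * ln x)) * real n powr (1 + x) = real n powr (x - 1 - x * ln x) * (real n)\<^sup>2"
    unfolding sq powr_add[symmetric] by (rule arg_cong[where f = "\<lambda>e. real n powr e"]) simp
  moreover have "x powr (- (x * ln (real n))) = real n powr (- (x * ln x))"
    using assms by (simp add: powr_def mult_ac)
  ultimately have eq: "x powr (- (x * ln (real n))) * ((1 + 1 / x) * real n powr (1 + x)) =
      (1 + 1 / x) * (real n powr (x - 1 - x * ln x) * (real n)\<^sup>2)"
    by (metis mult.left_commute)
  show 2: "(ln (real n))\<^sup>2 / (real n)\<^sup>2 * (x powr (- (x * ln (real n))) * ((1 + 1 / x) * real n powr (1 + x))) = chernoff_error x n"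
    unfolding eq chernoff_error_def using n by (simp add: field_simps)
  \<comment> \<open>From \<open>n \<ge> 3\<close> on, \<open>ln n \<ge> 1\<close>, so the
    first-moment error is dominated by the second-moment one.\<close>
  have "exp 1 \<le> real n" using exp_le assms(1) by linarith
  then have "1 \<le> ln (real n)" using n by (simp add: ln_ge_iff)
  then have "ln (real n) \<le> (ln (real n))\<^sup>2" by (simp add: power2_eq_square)
  then have "(ln (real n)) / (real n)\<^sup>2 * (x powr (- (x * ln (real n))) * ((1 + 1 / x) * real n powr (1 + x))) \<le>
      (ln (real n))\<^sup>2 / (real n)\<^sup>2 * (x powr (- (x * ln (real n))) * ((1 + 1 / x) * real n powr (1 + x)))"
    using assms by (intro mult_right_mono divide_right_mono) auto
  then show "ln (real n) / real n * (x powr (- (x * ln (real n))) * ((1 + 1 / x) * real n powr (1 + x)) / real n) \<le> chernoff_error x n"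
    unfolding 2 by (simp add: power2_eq_square)
qed

text \<open>Since \<open>ln n / n\<close> vanishes, so does \<open>p n\<close>; then
  \<open>- ln (1 - p n)\<close> lies between \<open>p n\<close> and \<open>p n / (1 - p n)\<close>,
  which have the same scaled limit.\<close>

lemma scaled_rate_tendsto:
  fixes p :: "nat \<Rightarrow> real"
  assumes p: "\<And>n. n \<ge> 1 \<Longrightarrow> 0 \<le> p n \<and> p n \<le> 1"
    and lim: "(\<lambda>n. real n * p n / ln (real n)) \<longlonglongrightarrow> c"
  shows "\<forall>\<^sub>F n in sequentially. p n < 1"
    and "(\<lambda>n. - ln (1 - p n) * real n / ln (real n)) \<longlonglongrightarrow> c"
proof -
  have "(\<lambda>n. real n * p n / ln (real n) * (ln (real n) / real n)) \<longlonglongrightarrow> c * 0"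
    by (intro tendsto_mult lim) real_asymp
  moreover have "\<forall>\<^sub>F n in sequentially. real n * p n / ln (real n) * (ln (real n) / real n) = p n"
    using eventually_ge_at_top[of 2] by eventually_elim simp
  ultimately have p0: "p \<longlonglongrightarrow> 0" by (simp add: tendsto_cong)
  then show lt: "\<forall>\<^sub>F n in sequentially. p n < 1" by (intro order_tendstoD) auto
  show "(\<lambda>n. - ln (1 - p n) * real n / ln (real n)) \<longlonglongrightarrow> c"
  proof (rule tendsto_sandwich[OF _ _ lim])
    show "(\<lambda>n. real n * p n / ln (real n) / (1 - p n)) \<longlonglongrightarrow> c"
      using tendsto_divide[OF lim tendsto_diff[OF tendsto_const[of 1] p0]] by simp
    show "\<forall>\<^sub>F n in sequentially. real n * p n / ln (real n) \<le> - ln (1 - p n) * real n / ln (real n)"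
      using lt eventually_ge_at_top[of 2]
    proof eventually_elim
      case (elim n)
      then have "p n * real n \<le> - ln (1 - p n) * real n"
        using minus_ln_le(1)[of "p n"] p[of n] by (intro mult_right_mono) auto
      then have "p n * real n / ln (real n) \<le> - ln (1 - p n) * real n / ln (real n)"
        using elim by (intro divide_right_mono) auto
      then show ?case by (simp add: mult.commute)
    qed
    show "\<forall>\<^sub>F n in sequentially. - ln (1 - p n) * real n / ln (real n) \<le> real n * p n / ln (real n) / (1 - p n)"
      using lt eventually_ge_at_top[of 2]
    proof eventually_elim
      case (elim n)
      then have "- ln (1 - p n) * real n \<le> p n / (1 - p n) * real n"
        using minus_ln_le(2)[of "p n"] p[of n] by (intro mult_right_mono) auto
      then have "- ln (1 - p n) * real n / ln (real n) \<le> p n / (1 - p n) * real n / ln (real n)"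
        using elim by (intro divide_right_mono) auto
      then show ?case by (simp add: mult_ac)
    qed
  qed
qed

section \<open>Passage to the limit\<close>

theorem theorem2:
  fixes c :: real and p :: "nat \<Rightarrow> real"
  assumes "c \<ge> 0"
    and "\<And>n. n \<ge> 1 \<Longrightarrow> 0 \<le> p n \<and> p n \<le> 1"
    and "(\<lambda>n. real n * p n / ln (real n)) \<longlonglongrightarrow> c"
  shows "(\<lambda>n. measure_pmf.prob (fire_model n (p n))
            {((T, s), X). \<exists>C \<in> fireproof_subtrees {1..n} T s. X \<in> C \<and> 1 \<in> C})
         \<longlonglongrightarrow> exp (- c)"
proof -
  let ?P = "\<lambda>n. measure_pmf.prob (fire_model n (p n))
            {((T, s), X). \<exists>C \<in> fireproof_subtrees {1..n} T s. X \<in> C \<and> 1 \<in> C}"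
  \<comment> \<open>This \<open>a\<close> turns \<open>(1 - p n) ^ K\<close> into
    \<open>exp (- a n * K)\<close>; \<alpha> is the same rate measured in units of
    \<open>ln n / n\<close>.\<close>
  define a where "a n = - ln (1 - p n)" for n
  define \<alpha> where "\<alpha> n = a n * real n / ln (real n)" for n
  have rate: "\<forall>\<^sub>F n in sequentially. p n < 1"
      "(\<lambda>n. - ln (1 - p n) * real n / ln (real n)) \<longlonglongrightarrow> c"
    by (rule scaled_rate_tendsto[OF _ assms(3)]; use assms(2) in blast)+
  have \<alpha>: "\<alpha> \<longlonglongrightarrow> c" using rate(2) by (simp add: \<alpha>_def[abs_def] a_def)
  \<comment> \<open>The parameter \<open>x\<close> serves both as Chernoff base and as the fraction
    of \<open>ln n\<close> taken for \<open>M\<close>. It stays fixed while \<open>n\<close> grows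
    and tends to \<open>1\<close> only afterwards.\<close>
  define lower where "lower x n = exp (- c) * (1 + c - \<alpha> n * (1 / x + chernoff_error x n))" for x n
  define upper where "upper x n = exp (- c) * (1 + c - \<alpha> n * (1 - 2 / real n)) +
      ((\<alpha> n)\<^sup>2 * (1 / x\<^sup>2 + 2 * chernoff_error x n) - 2 * c * (\<alpha> n * (1 - 2 / real n)) + c\<^sup>2)" for x n
  have bounds: "\<forall>\<^sub>F n in sequentially. lower x n \<le> ?P n \<and> ?P n \<le> upper x n" if x: "0 < x" "x < 1" for x
    using rate(1) eventually_ge_at_top[of 3]
  proof eventually_elim
    case (elim n)
    define L where "L = ln (real n)"
    define N where "N = real n"
    define e where "e = x powr (- (x * L)) * ((1 + 1 / x) * N powr (1 + x))"
    have L: "L > 0" and n: "n \<ge> 1" "n \<ge> 2" and N: "N > 0" "N \<ge> 3" using elim by (auto simp: L_def N_def)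
    have a: "0 \<le> a n" using minus_ln_le(1)[of "p n"] elim assms(2)[of n] by (simp add: a_def)
    have \<alpha>_eq: "a n = \<alpha> n * (L / N)" using L N by (simp add: \<alpha>_def L_def N_def)
    have \<alpha>_nonneg: "0 \<le> \<alpha> n" using a L by (simp add: \<alpha>_def L_def)
    have "1 - p n = exp (- a n)" using elim by (simp add: a_def)
    then have P: "?P n = avg {1..n} (\<lambda>X. tree_avg n (\<lambda>f es. exp (- a n) ^ hits (ancestors f X) es))"
      using fire_model_prob[of n "p n"] assms(2)[of n] n by (simp only: tree_avg_def)
    define K' where "K' = avg {1..n} (\<lambda>X. tree_avg n (\<lambda>f es. real (hits (ancestors f X) es)))"
    define K1 where "K1 = tree_avg n (\<lambda>f es. real (hits (ancestors f 1) es))"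
    define K2 where "K2 = tree_avg n (\<lambda>f es. (real (hits (ancestors f 1) es))\<^sup>2)"
    have err: "L / N * (e / N) \<le> chernoff_error x n" "L\<^sup>2 / N\<^sup>2 * e = chernoff_error x n"
      using chernoff_error_bound[of n x] elim x by (auto simp: L_def N_def e_def)
    have "K' \<le> N / (x * L) + e / N"
      using mean_hits_le[of n x "x * L"] x L n unfolding K'_def N_def e_def by simp
    then have "L / N * K' \<le> L / N * (N / (x * L) + e / N)"
      using L N by (intro mult_left_mono) auto
    also have "\<dots> = 1 / x + L / N * (e / N)" using L N by (simp add: field_simps)
    finally have "L / N * K' \<le> 1 / x + chernoff_error x n" using err by simp
    then have "a n * K' \<le> \<alpha> n * (1 / x + chernoff_error x n)"
      unfolding \<alpha>_eq mult.assoc using \<alpha>_nonneg by (rule mult_left_mono)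
    then have "lower x n \<le> exp (- c) * (1 + c - a n * K')"
      unfolding lower_def by (intro mult_left_mono) auto
    also have "\<dots> \<le> ?P n" unfolding P K'_def by (rule fire_prob_ge[OF n(1) a])
    finally have low: "lower x n \<le> ?P n" .
    have "(N - 2) / L \<le> K1" using mean_hits_ge[OF n(2)] by (simp add: K1_def L_def N_def)
    then have "L / N * ((N - 2) / L) \<le> L / N * K1" using L N by (intro mult_left_mono) auto
    moreover have "L / N * ((N - 2) / L) = 1 - 2 / N" using L N by (simp add: field_simps)
    ultimately have "1 - 2 / N \<le> L / N * K1" by simp
    then have k1: "\<alpha> n * (1 - 2 / N) \<le> a n * K1"
      unfolding \<alpha>_eq mult.assoc using \<alpha>_nonneg by (rule mult_left_mono)
    have "K2 \<le> N\<^sup>2 / (x * L)\<^sup>2 + 2 * e"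
      using mean_square_hits_le[of n x "x * L"] x L n unfolding K2_def N_def e_def by simp
    then have "L\<^sup>2 / N\<^sup>2 * K2 \<le> L\<^sup>2 / N\<^sup>2 * (N\<^sup>2 / (x * L)\<^sup>2 + 2 * e)"
      by (intro mult_left_mono) auto
    also have "\<dots> = 1 / x\<^sup>2 + 2 * (L\<^sup>2 / N\<^sup>2 * e)"
      using L N x by (simp add: distrib_left power_mult_distrib)
    finally have "L\<^sup>2 / N\<^sup>2 * K2 \<le> 1 / x\<^sup>2 + 2 * chernoff_error x n" unfolding err(2) .
    then have "(\<alpha> n)\<^sup>2 * (L\<^sup>2 / N\<^sup>2 * K2) \<le> (\<alpha> n)\<^sup>2 * (1 / x\<^sup>2 + 2 * chernoff_error x n)"
      by (intro mult_left_mono) auto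
    then have k2: "(a n)\<^sup>2 * K2 \<le> (\<alpha> n)\<^sup>2 * (1 / x\<^sup>2 + 2 * chernoff_error x n)"
      unfolding \<alpha>_eq by (simp add: power_mult_distrib power_divide mult.assoc)
    have "?P n \<le> exp (- c) * (1 + c - a n * K1) + ((a n)\<^sup>2 * K2 - 2 * a n * c * K1 + c\<^sup>2)"
      unfolding P K1_def K2_def by (rule fire_prob_le[OF n(1) a assms(1)])
    also have "\<dots> = exp (- c) * (1 + c - a n * K1) + ((a n)\<^sup>2 * K2 - 2 * c * (a n * K1) + c\<^sup>2)"
      by (simp add: mult_ac)
    also have "\<dots> \<le> upper x n"
      unfolding upper_def N_def[symmetric] using k1 k2 assms(1)
      by (intro add_mono diff_mono mult_left_mono) auto
    finally show ?case using low by blast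
  qed
  have lower_lim: "lower x \<longlonglongrightarrow> exp (- c) * (1 + c - c * (1 / x + 0))" if "0 < x" "x < 1" for x
    unfolding lower_def by (intro tendsto_intros \<alpha> chernoff_error_tendsto that)
  have inv: "(\<lambda>n. 2 / real n) \<longlonglongrightarrow> 0" by real_asymp
  have upper_lim: "upper x \<longlonglongrightarrow> exp (- c) * (1 + c - c * (1 - 0)) +
      (c\<^sup>2 * (1 / x\<^sup>2 + 2 * 0) - 2 * c * (c * (1 - 0)) + c\<^sup>2)" if "0 < x" "x < 1" for x
    unfolding upper_def by (intro tendsto_intros \<alpha> inv chernoff_error_tendsto that)
  have near_1: "\<forall>\<^sub>F x in at_left (1::real). 0 < x \<and> x < 1"
    unfolding eventually_at_left_field by (intro exI[of _ 0]) auto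
  show ?thesis
  proof (rule order_tendstoI)
    fix l assume l: "l < exp (- c)"
    \<comment> \<open>At \<open>x = 1\<close> the tangent is evaluated at \<open>c\<close> itself
      and equals \<open>exp (- c)\<close>.\<close>
    have "((\<lambda>x. exp (- c) * (1 + c - c * (1 / x + 0))) \<longlongrightarrow> exp (- c) * (1 + c - c * (1 / 1 + 0))) (at_left 1)"
      by (intro tendsto_intros) auto
    then have "\<forall>\<^sub>F x in at_left 1. l < exp (- c) * (1 + c - c * (1 / x + 0))"
      using l by (intro order_tendstoD(1)) auto
    then obtain x where x: "0 < x" "x < 1" "l < exp (- c) * (1 + c - c * (1 / x + 0))"
      using eventually_happens'[OF trivial_limit_at_left_real eventually_conj[OF near_1]] by blast
    have "\<forall>\<^sub>F n in sequentially. l < lower x n"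
      by (rule order_tendstoD(1)[OF lower_lim[OF x(1,2)] x(3)])
    with bounds[OF x(1,2)] show "\<forall>\<^sub>F n in sequentially. l < ?P n"
      by eventually_elim linarith
  next
    fix u assume u: "exp (- c) < u"
    \<comment> \<open>At \<open>x = 1\<close> the quadratic part becomes
      \<open>c * c - 2 * c * c + c * c = 0\<close>: asymptotically the second moment bound leaves no
      variance.\<close>
    have "((\<lambda>x. exp (- c) * (1 + c - c * (1 - 0)) + (c\<^sup>2 * (1 / x\<^sup>2 + 2 * 0) - 2 * c * (c * (1 - 0)) + c\<^sup>2)) \<longlongrightarrow>
        exp (- c) * (1 + c - c * (1 - 0)) + (c\<^sup>2 * (1 / 1\<^sup>2 + 2 * 0) - 2 * c * (c * (1 - 0)) + c\<^sup>2)) (at_left 1)"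
      by (intro tendsto_intros) auto
    then have "\<forall>\<^sub>F x in at_left 1. exp (- c) * (1 + c - c * (1 - 0)) +
        (c\<^sup>2 * (1 / x\<^sup>2 + 2 * 0) - 2 * c * (c * (1 - 0)) + c\<^sup>2) < u"
      using u by (intro order_tendstoD(2)) (auto simp: power2_eq_square)
    then obtain x where x: "0 < x" "x < 1" "exp (- c) * (1 + c - c * (1 - 0)) +
        (c\<^sup>2 * (1 / x\<^sup>2 + 2 * 0) - 2 * c * (c * (1 - 0)) + c\<^sup>2) < u"
      using eventually_happens'[OF trivial_limit_at_left_real eventually_conj[OF near_1]] by blast
    have "\<forall>\<^sub>F n in sequentially. upper x n < u"
      by (rule order_tendstoD(2)[OF upper_lim[OF x(1,2)] x(3)])
    with bounds[OF x(1,2)] show "\<forall>\<^sub>F n in sequentially. ?P n < u"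
      by eventually_elim linarith
  qed
qed

end
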